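(* Let $d\ge 2$ be an integer, let $\langle F;+,\cdot,0,1,<\rangle$ be an ordered field, let $c\in F$ be an element that is not parameter-free definable in $\langle F;+,\cdot,0,1,<\rangle$, and let $\mathcal F_c=\langle F;+,\cdot,0,1,<,c\rangle$ be the expansion by a constant symbol naming $c$. Define $Q_c\subseteq (F^d)^3$ by $Q_c(x,y,z)\iff y=x+c(z-x)$, and let $\mathcal G_c=\langle F^d;\mathsf{Bw},Q_c\rangle$. Then $\mathcal G_c$ is semilinearly faithful over $\mathcal F_c$.
   Context: $\mathsf{Bw}$ is the betweenness relation on $F^d$: $\mathsf{Bw}(a,b,c')\iff\exists t\in F\,(0\le t\le 1\wedge b=(1-t)a+tc')$. For an ultrafilter $U$ on a set $I$, $\mathcal F_c^U$ is the ultrapower of $\mathcal F_c$, with universe $F^U$ (the constant symbol being interpreted by the class of the constant function $c$), and $\mathcal G_c(\mathcal F_c^U)=\langle (F^U)^d;\mathsf{Bw}^U,Q_c^U\rangle$, where both relations are defined in $\mathcal F_c^U$ by the same formulas that define them in $\mathcal F_c$. Affine maps of $(F^U)^d$ are maps $x\mapsto Ax+b$ with $A\in\mathrm{GL}_d(F^U)$, $b\in(F^U)^d$; $\mathrm{AffAut}(\mathcal G_c(\mathcal F_c^U))$ is the group of automorphisms of $\mathcal G_c(\mathcal F_c^U)$ that are affine. $\mathcal G_c$ is semilinearly faithful over $\mathcal F_c$ if for every ultrafilter $U$ (on any set) and every $\alpha\in\mathrm{Aut}(\mathcal G_c(\mathcal F_c^U))$ there exist $A\in\mathrm{AffAut}(\mathcal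 G_c(\mathcal F_c^U))$ and $\sigma\in\mathrm{Aut}(\mathcal F_c^U)$ (an ordered-field automorphism fixing the named constant) such that $\alpha=A\circ\widetilde\sigma$, where $\widetilde\sigma(x_1,\dots,x_d)=(\sigma(x_1),\dots,\sigma(x_d))$. *)

theory Defs
  imports "HOL-Algebra.QuotRing"
begin

text \<open>
  Ultrapowers of an ordered field depend on an ultrafilter, so they are not types. Structures in the
  language of ordered rings are therefore represented as extensions of the ring records of
  HOL-Algebra. The given ordered field itself is a type of class \<open>linordered_field\<close>.
\<close>

record 'a oring = "'a ring" +
  lt :: "'a \<Rightarrow> 'a \<Rightarrow> bool" (infixl \<open>\<prec>\<index>\<close> 50)

record 'a named_oring = "'a oring" +
  named :: 'a

definition ordered_field :: "'a::linordered_field oring" where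
  "ordered_field = \<lparr>carrier = UNIV, monoid.mult = (*), one = 1, zero = 0, add = (+), lt = (<)\<rparr>"

definition named_field :: "'a::linordered_field \<Rightarrow> 'a named_oring" where
  "named_field c =
     \<lparr>carrier = UNIV, monoid.mult = (*), one = 1, zero = 0, add = (+), lt = (<), named = c\<rparr>"


subsection \<open>First-order definability in the language of ordered rings\<close>

datatype tm = Var nat | Zero | One | Plus tm tm | Times tm tm

datatype fm = Eq tm tm | Less tm tm | Neg fm | Conj fm fm | Exi nat fm

primrec tm_val :: "('a, 'm) oring_scheme \<Rightarrow> (nat \<Rightarrow> 'a) \<Rightarrow> tm \<Rightarrow> 'a" where
  "tm_val R s (Var n) = s n"
| "tm_val R s Zero = \<zero>\<^bsub>R\<^esub>"
| "tm_val R s One = \<one>\<^bsub>R\<^esub>"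
| "tm_val R s (Plus t u) = tm_val R s t \<oplus>\<^bsub>R\<^esub> tm_val R s u"
| "tm_val R s (Times t u) = tm_val R s t \<otimes>\<^bsub>R\<^esub> tm_val R s u"

primrec sat :: "('a, 'm) oring_scheme \<Rightarrow> (nat \<Rightarrow> 'a) \<Rightarrow> fm \<Rightarrow> bool" where
  "sat R s (Eq t u) \<longleftrightarrow> tm_val R s t = tm_val R s u"
| "sat R s (Less t u) \<longleftrightarrow> tm_val R s t \<prec>\<^bsub>R\<^esub> tm_val R s u"
| "sat R s (Neg p) \<longleftrightarrow> \<not> sat R s p"
| "sat R s (Conj p q) \<longleftrightarrow> sat R s p \<and> sat R s q"
| "sat R s (Exi n p) \<longleftrightarrow> (\<exists>a\<in>carrier R. sat R (s(n := a)) p)"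

primrec tm_vars :: "tm \<Rightarrow> nat set" where
  "tm_vars (Var n) = {n}"
| "tm_vars Zero = {}"
| "tm_vars One = {}"
| "tm_vars (Plus t u) = tm_vars t \<union> tm_vars u"
| "tm_vars (Times t u) = tm_vars t \<union> tm_vars u"

primrec free_vars :: "fm \<Rightarrow> nat set" where
  "free_vars (Eq t u) = tm_vars t \<union> tm_vars u"
| "free_vars (Less t u) = tm_vars t \<union> tm_vars u"
| "free_vars (Neg p) = free_vars p"
| "free_vars (Conj p q) = free_vars p \<union> free_vars q"
| "free_vars (Exi n p) = free_vars p - {n}"

text \<open>
  At most the variable \<open>0\<close> is free in the defining formula, so the value that the constant
  assignment below gives to the other variables is irrelevant: there are no hidden parameters.
\<close>

definition definable_element :: "('a, 'm) oring_scheme \<Rightarrow> 'a \<Rightarrow> bool" where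
  "definable_element R c \<longleftrightarrow>
     (\<exists>p. free_vars p \<subseteq> {0} \<and> (\<forall>a\<in>carrier R. sat R (\<lambda>_. a) p \<longleftrightarrow> a = c))"


subsection \<open>Ultrapowers\<close>

text \<open>The index set is the whole type \<open>'i\<close>.\<close>

definition ultrafilter :: "'i filter \<Rightarrow> bool" where
  "ultrafilter U \<longleftrightarrow>
     U \<noteq> bot \<and> (\<forall>P. eventually P U \<or> eventually (\<lambda>i. \<not> P i) U)"

definition up_rel ::
  "'i filter \<Rightarrow> ('a, 'm) partial_object_scheme \<Rightarrow> (('i \<Rightarrow> 'a) \<times> ('i \<Rightarrow> 'a)) set" where
  "up_rel U R = {(f, g). range f \<subseteq> carrier R \<and> range g \<subseteq> carrier R \<and> (\<forall>\<^sub>F i in U. f i = g i)}"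

definition up_class ::
  "'i filter \<Rightarrow> ('a, 'm) partial_object_scheme \<Rightarrow> ('i \<Rightarrow> 'a) \<Rightarrow> ('i \<Rightarrow> 'a) set" where
  "up_class U R f = up_rel U R `` {f}"

text \<open>
  As usual for operations on quotients, the unions below are unions of a single equivalence class.
\<close>

definition ultrapower ::
  "'i filter \<Rightarrow> 'a named_oring \<Rightarrow> ('i \<Rightarrow> 'a) set named_oring" where
  "ultrapower U R =
     \<lparr>carrier = {f. range f \<subseteq> carrier R} // up_rel U R,
      monoid.mult = (\<lambda>X Y. \<Union>f\<in>X. \<Union>g\<in>Y. up_class U R (\<lambda>i. f i \<otimes>\<^bsub>R\<^esub> g i)),
      one = up_class U R (\<lambda>_. \<one>\<^bsub>R\<^esub>),
      zero = up_class U R (\<lambda>_. \<zero>\<^bsub>R\<^esub>),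
      add = (\<lambda>X Y. \<Union>f\<in>X. \<Union>g\<in>Y. up_class U R (\<lambda>i. f i \<oplus>\<^bsub>R\<^esub> g i)),
      lt = (\<lambda>X Y. \<exists>f\<in>X. \<exists>g\<in>Y. \<forall>\<^sub>F i in U. f i \<prec>\<^bsub>R\<^esub> g i),
      named = up_class U R (\<lambda>_. named R)\<rparr>"

definition field_aut :: "('a, 'm) named_oring_scheme \<Rightarrow> ('a \<Rightarrow> 'a) set" where
  "field_aut R =
     {\<sigma> \<in> ring_iso R R.
        (\<forall>x\<in>carrier R. \<forall>y\<in>carrier R. x \<prec>\<^bsub>R\<^esub> y \<longleftrightarrow> \<sigma> x \<prec>\<^bsub>R\<^esub> \<sigma> y) \<and> \<sigma> (named R) = named R}"


subsection \<open>The geometry of betweenness and the named ratio\<close>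

text \<open>
  Points of the \<open>d\<close>-dimensional space are extensional functions on \<open>{..<d}\<close>. The relations are
  defined uniformly over an arbitrary structure, so that instantiating them with \<open>named_field c\<close>
  and with an ultrapower of it evaluates the same first-order formulas in both.
\<close>

record 'p geometry =
  points :: "'p set"
  btw :: "'p \<Rightarrow> 'p \<Rightarrow> 'p \<Rightarrow> bool"
  ratio :: "'p \<Rightarrow> 'p \<Rightarrow> 'p \<Rightarrow> bool"

definition coord_space :: "nat \<Rightarrow> ('a, 'm) partial_object_scheme \<Rightarrow> (nat \<Rightarrow> 'a) set" where
  "coord_space d R = {..<d} \<rightarrow>\<^sub>E carrier R"

definition Bw ::
  "nat \<Rightarrow> ('a, 'm) oring_scheme \<Rightarrow> (nat \<Rightarrow> 'a) \<Rightarrow> (nat \<Rightarrow> 'a) \<Rightarrow> (nat \<Rightarrow> 'a) \<Rightarrow> bool" where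
  "Bw d R x y z \<longleftrightarrow>
     (\<exists>t\<in>carrier R. (\<zero>\<^bsub>R\<^esub> \<prec>\<^bsub>R\<^esub> t \<or> \<zero>\<^bsub>R\<^esub> = t) \<and> (t \<prec>\<^bsub>R\<^esub> \<one>\<^bsub>R\<^esub> \<or> t = \<one>\<^bsub>R\<^esub>) \<and>
        (\<forall>k<d. y k = ((\<one>\<^bsub>R\<^esub> \<ominus>\<^bsub>R\<^esub> t) \<otimes>\<^bsub>R\<^esub> x k) \<oplus>\<^bsub>R\<^esub> (t \<otimes>\<^bsub>R\<^esub> z k)))"

definition Qr ::
  "nat \<Rightarrow> ('a, 'm) named_oring_scheme \<Rightarrow> (nat \<Rightarrow> 'a) \<Rightarrow> (nat \<Rightarrow> 'a) \<Rightarrow> (nat \<Rightarrow> 'a) \<Rightarrow> bool" where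
  "Qr d R x y z \<longleftrightarrow> (\<forall>k<d. y k = x k \<oplus>\<^bsub>R\<^esub> (named R \<otimes>\<^bsub>R\<^esub> (z k \<ominus>\<^bsub>R\<^esub> x k)))"

definition geometry_over :: "nat \<Rightarrow> ('a, 'm) named_oring_scheme \<Rightarrow> (nat \<Rightarrow> 'a) geometry" where
  "geometry_over d R = \<lparr>points = coord_space d R, btw = Bw d R, ratio = Qr d R\<rparr>"

definition geom_aut :: "'p geometry \<Rightarrow> ('p \<Rightarrow> 'p) set" where
  "geom_aut G =
     {\<alpha>. bij_betw \<alpha> (points G) (points G) \<and>
        (\<forall>x\<in>points G. \<forall>y\<in>points G. \<forall>z\<in>points G.
           (btw G x y z \<longleftrightarrow> btw G (\<alpha> x) (\<alpha> y) (\<alpha> z)) \<and>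
           (ratio G x y z \<longleftrightarrow> ratio G (\<alpha> x) (\<alpha> y) (\<alpha> z)))}"


subsection \<open>Affine and semilinear maps\<close>

text \<open>Of a matrix \<open>M\<close>, only the entries \<open>M i j\<close> with \<open>i, j < d\<close> matter.\<close>

definition mats :: "nat \<Rightarrow> ('a, 'm) partial_object_scheme \<Rightarrow> (nat \<Rightarrow> nat \<Rightarrow> 'a) set" where
  "mats d R = {M. \<forall>i<d. \<forall>j<d. M i j \<in> carrier R}"

definition inverse_mats ::
  "nat \<Rightarrow> ('a, 'm) ring_scheme \<Rightarrow> (nat \<Rightarrow> nat \<Rightarrow> 'a) \<Rightarrow> (nat \<Rightarrow> nat \<Rightarrow> 'a) \<Rightarrow> bool" where
  "inverse_mats d R M N \<longleftrightarrow>
     (\<forall>i<d. \<forall>j<d.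
        (\<Oplus>\<^bsub>R\<^esub>k\<in>{..<d}. M i k \<otimes>\<^bsub>R\<^esub> N k j) = (if i = j then \<one>\<^bsub>R\<^esub> else \<zero>\<^bsub>R\<^esub>) \<and>
        (\<Oplus>\<^bsub>R\<^esub>k\<in>{..<d}. N i k \<otimes>\<^bsub>R\<^esub> M k j) = (if i = j then \<one>\<^bsub>R\<^esub> else \<zero>\<^bsub>R\<^esub>))"

definition GL :: "nat \<Rightarrow> ('a, 'm) ring_scheme \<Rightarrow> (nat \<Rightarrow> nat \<Rightarrow> 'a) set" where
  "GL d R = {M \<in> mats d R. \<exists>N\<in>mats d R. inverse_mats d R M N}"

definition affine_map ::
  "nat \<Rightarrow> ('a, 'm) ring_scheme \<Rightarrow> (nat \<Rightarrow> nat \<Rightarrow> 'a) \<Rightarrow> (nat \<Rightarrow> 'a) \<Rightarrow> (nat \<Rightarrow> 'a) \<Rightarrow> nat \<Rightarrow> 'a" where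
  "affine_map d R M b x = (\<lambda>i\<in>{..<d}. (\<Oplus>\<^bsub>R\<^esub>j\<in>{..<d}. M i j \<otimes>\<^bsub>R\<^esub> x j) \<oplus>\<^bsub>R\<^esub> b i)"

definition aff_aut ::
  "nat \<Rightarrow> ('a, 'm) named_oring_scheme \<Rightarrow> ((nat \<Rightarrow> 'a) \<Rightarrow> nat \<Rightarrow> 'a) set" where
  "aff_aut d R =
     {A \<in> geom_aut (geometry_over d R).
        \<exists>M\<in>GL d R. \<exists>b\<in>coord_space d R. \<forall>x\<in>coord_space d R. A x = affine_map d R M b x}"

definition coordinatewise :: "nat \<Rightarrow> ('a \<Rightarrow> 'a) \<Rightarrow> (nat \<Rightarrow> 'a) \<Rightarrow> nat \<Rightarrow> 'a" where
  "coordinatewise d \<sigma> x = (\<lambda>i\<in>{..<d}. \<sigma> (x i))"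

text \<open>
  A formula cannot quantify over types, so the type of indices of the ultrafilters is a parameter;
  a theorem with a free type variable \<open>'i\<close> covers all index sets.
\<close>

definition semilinearly_faithful :: "'i itself \<Rightarrow> nat \<Rightarrow> 'a named_oring \<Rightarrow> bool" where
  "semilinearly_faithful (_ :: 'i itself) d R \<longleftrightarrow>
     (\<forall>U :: 'i filter. ultrafilter U \<longrightarrow>
        (\<forall>\<alpha>\<in>geom_aut (geometry_over d (ultrapower U R)).
           \<exists>A\<in>aff_aut d (ultrapower U R). \<exists>\<sigma>\<in>field_aut (ultrapower U R).
             \<forall>x\<in>coord_space d (ultrapower U R). \<alpha> x = (A \<circ> coordinatewise d \<sigma>) x))"

end

(*
  The ultrapower is again an ordered field, so the claim is the fundamental theorem of affine
  geometry over an arbitrary ordered field. Collinearity, and hence the fourth vertex of a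
  nondegenerate parallelogram, is expressible by betweenness. An automorphism, translated so as to
  fix the origin, is therefore additive, and it multiplies scalars by some \<sigma> that is read off from
  one line. Betweenness on this line makes \<sigma> monotone, and the ratio relation forces \<sigma> to fix the
  named constant. Precomposing with the coordinatewise inverse of \<sigma> leaves a linear bijection.
*)

theory Submission
  imports Defs
begin

section \<open>Ordered fields as structures\<close>

text \<open>Dependence between vectors is the recurring obstacle. A parallelogram yields u + v only
  when 0, u and v are not collinear, so sums within a line need an auxiliary vector off that line,
  which \<open>2 \<le> d\<close> supplies. Likewise, preservation of lines through the origin gives
  a factor that might vary with the line; the factors on two independent vectors are compared
  through the image of their sum. The order enters through the unit interval, the range of the
  parameter in \<open>Bw\<close>. Every scalar is related to it in one of three ways, which is why
  three betweenness statements exhaust a line, and a bijective ring homomorphism that preserves it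
  also preserves positivity. An ordered field may have nontrivial automorphisms, so \<sigma> cannot
  be expected to be the identity. For the ultrapower, the axioms of ordered fields are checked on
  representatives, index by index, instead of being derived from a general transfer
  principle.\<close>

locale ordered_field_structure = field R for R :: "('a, 'm) oring_scheme" (structure) +
  assumes lt_irrefl: "x \<in> carrier R \<Longrightarrow> \<not> x \<prec> x"
    and lt_trans: "\<lbrakk>x \<in> carrier R; y \<in> carrier R; z \<in> carrier R; x \<prec> y; y \<prec> z\<rbrakk> \<Longrightarrow> x \<prec> z"
    and lt_linear: "\<lbrakk>x \<in> carrier R; y \<in> carrier R\<rbrakk> \<Longrightarrow> x \<prec> y \<or> x = y \<or> y \<prec> x"
    and lt_add: "\<lbrakk>x \<in> carrier R; y \<in> carrier R; z \<in> carrier R; x \<prec> y\<rbrakk> \<Longrightarrow> x \<oplus> z \<prec> y \<oplus> z"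
    and lt_mult: "\<lbrakk>x \<in> carrier R; y \<in> carrier R; \<zero> \<prec> x; \<zero> \<prec> y\<rbrakk> \<Longrightarrow> \<zero> \<prec> x \<otimes> y"
begin

text \<open>The range of the parameter in \<open>Bw\<close>, with the weak inequalities spelled out
  as they are there.\<close>

definition unit_interval :: "'a set" where
  "unit_interval = {t \<in> carrier R. (\<zero> \<prec> t \<or> \<zero> = t) \<and> (t \<prec> \<one> \<or> t = \<one>)}"

lemma unit_interval_carrier: "t \<in> unit_interval \<Longrightarrow> t \<in> carrier R"
  by (simp add: unit_interval_def)

lemma minus_eq_zero_iff:
  assumes "x \<in> carrier R" "y \<in> carrier R"
  shows "x \<ominus> y = \<zero> \<longleftrightarrow> x = y"
proof
  have "x = (x \<ominus> y) \<oplus> y" using assms by algebra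
  then show "x = y" if "x \<ominus> y = \<zero>" using that assms by simp
qed (use assms in \<open>simp add: minus_eq r_neg\<close>)

lemma lt_iff_pos_diff:
  assumes x: "x \<in> carrier R" and y: "y \<in> carrier R"
  shows "x \<prec> y \<longleftrightarrow> \<zero> \<prec> y \<ominus> x"
proof
  assume "x \<prec> y"
  then have "x \<oplus> \<ominus> x \<prec> y \<oplus> \<ominus> x" using x y by (intro lt_add) auto
  then show "\<zero> \<prec> y \<ominus> x" using x y by (simp add: r_neg a_minus_def)
next
  assume "\<zero> \<prec> y \<ominus> x"
  then have "\<zero> \<oplus> x \<prec> (y \<ominus> x) \<oplus> x" using x y by (intro lt_add) auto
  moreover have "(y \<ominus> x) \<oplus> x = y" using x y by algebra
  ultimately show "x \<prec> y" using x by simp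
qed

lemma pos_add:
  assumes "x \<in> carrier R" "y \<in> carrier R" "\<zero> \<prec> x" "\<zero> \<prec> y"
  shows "\<zero> \<prec> x \<oplus> y"
proof -
  have "\<zero> \<oplus> y \<prec> x \<oplus> y" using assms by (intro lt_add) auto
  then show ?thesis using assms lt_trans[of \<zero> y "x \<oplus> y"] by simp
qed

lemma not_pos_and_neg:
  assumes "x \<in> carrier R" "\<zero> \<prec> x" shows "\<not> \<zero> \<prec> \<ominus> x"
proof
  assume "\<zero> \<prec> \<ominus> x"
  then have "\<zero> \<prec> x \<oplus> \<ominus> x" using assms by (intro pos_add) auto
  then show False using assms lt_irrefl[of \<zero>] by (simp add: r_neg)
qed

lemma pos_cases:
  assumes x: "x \<in> carrier R"
  shows "x = \<zero> \<or> \<zero> \<prec> x \<or> \<zero> \<prec> \<ominus> x"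
proof -
  have "x \<prec> \<zero> \<Longrightarrow> \<zero> \<prec> \<ominus> x"
    using x lt_iff_pos_diff[of x \<zero>] by (simp add: a_minus_def)
  then show ?thesis using lt_linear[of x \<zero>] x by auto
qed

text \<open>If \<open>\<ominus> \<one>\<close> were positive, its square \<open>\<one>\<close> would
  be positive as well, which is impossible for an element and its negative.\<close>

lemma one_pos: "\<zero> \<prec> \<one>"
proof -
  have False if "\<zero> \<prec> \<ominus> \<one>"
  proof -
    have "\<zero> \<prec> (\<ominus> \<one>) \<otimes> (\<ominus> \<one>)" using that by (intro lt_mult) auto
    moreover have "(\<ominus> \<one>) \<otimes> (\<ominus> \<one>) = \<one>" by algebra
    ultimately show False using that not_pos_and_neg[of \<one>] by simp
  qed
  then show ?thesis using pos_cases[of \<one>] by auto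
qed

lemma pos_of_mult_one:
  assumes "x \<in> carrier R" "y \<in> carrier R" "\<zero> \<prec> x" "y \<otimes> x = \<one>"
  shows "\<zero> \<prec> y"
proof -
  have "y \<noteq> \<zero>" using assms by auto
  moreover have False if "\<zero> \<prec> \<ominus> y"
  proof -
    have "\<zero> \<prec> (\<ominus> y) \<otimes> x" using assms that by (intro lt_mult) auto
    then have "\<zero> \<prec> \<ominus> \<one>" using assms by (simp add: l_minus)
    then show False using not_pos_and_neg[of \<one>] one_pos by simp
  qed
  ultimately show ?thesis using pos_cases[of y] assms by auto
qed

lemma nonzero_inverse:
  assumes "x \<in> carrier R" "x \<noteq> \<zero>"
  obtains y where "y \<in> carrier R" "y \<otimes> x = \<one>"
  using assms field_Units Units_def[of R] by auto

lemma inverse_gt_one_in_unit_interval: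
  assumes "x \<in> carrier R" "y \<in> carrier R" "\<one> \<prec> x" "y \<otimes> x = \<one>"
  shows "y \<in> unit_interval"
proof -
  have x: "\<zero> \<prec> x" using lt_trans[of \<zero> \<one> x] assms one_pos by simp
  have y: "\<zero> \<prec> y" using pos_of_mult_one x assms by blast
  \<comment> \<open>As y is the inverse of x, multiplying x - 1 by y gives 1 - y; both factors are
    positive.\<close>
  have "\<zero> \<prec> y \<otimes> (x \<ominus> \<one>)"
    using assms y lt_iff_pos_diff[of \<one> x] by (intro lt_mult) auto
  also have "y \<otimes> (x \<ominus> \<one>) = \<one> \<ominus> y"
  proof -
    have "y \<otimes> (x \<ominus> \<one>) = y \<otimes> x \<ominus> y" using assms(1,2) by algebra
    then show ?thesis by (simp add: assms)
  qed
  finally have "y \<prec> \<one>" using lt_iff_pos_diff[of y \<one>] assms by simp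
  then show ?thesis using y assms by (simp add: unit_interval_def)
qed

lemma zero_in_unit_interval: "\<zero> \<in> unit_interval"
  and one_in_unit_interval: "\<one> \<in> unit_interval"
  using one_pos by (auto simp: unit_interval_def)

lemma pos_unit_interval_cases:
  assumes "r \<in> carrier R" "\<zero> \<prec> r"
  shows "r \<in> unit_interval \<or> (\<exists>s\<in>unit_interval. s \<otimes> r = \<one>)"
proof (cases "\<one> \<prec> r")
  case True
  have "r \<noteq> \<zero>" using assms lt_irrefl by auto
  then obtain s where "s \<in> carrier R" "s \<otimes> r = \<one>" using nonzero_inverse assms by blast
  then show ?thesis using inverse_gt_one_in_unit_interval assms True by blast
next
  case False
  then show ?thesis using assms lt_linear[of r \<one>] by (auto simp: unit_interval_def)
qed

lemma unit_interval_compl: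
  assumes "t \<in> unit_interval" shows "\<one> \<ominus> t \<in> unit_interval"
proof -
  have t: "t \<in> carrier R" using assms by (simp add: unit_interval_def)
  have "\<one> \<ominus> (\<one> \<ominus> t) = t" "\<one> \<ominus> \<one> = \<zero>" "\<one> \<ominus> \<zero> = \<one>" using t by algebra+
  then show ?thesis
    using assms t lt_iff_pos_diff[of t \<one>] lt_iff_pos_diff[of "\<one> \<ominus> t" \<one>]
    by (auto simp: unit_interval_def)
qed

text \<open>The equation is r + s (1 - r) = 0: on the scalar line, 0 lies between r and 1 with
  parameter s. The witness is s = 1 - y with y the inverse of 1 - r, which exceeds 1.\<close>

lemma neg_unit_interval:
  assumes r: "r \<in> carrier R" and neg: "\<zero> \<prec> \<ominus> r"
  shows "\<exists>s\<in>unit_interval. s \<otimes> (\<one> \<ominus> r) = \<ominus> r"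
proof -
  have "\<one> \<ominus> r \<ominus> \<one> = \<ominus> r" using r by algebra
  then have gt: "\<one> \<prec> \<one> \<ominus> r"
    using neg r lt_iff_pos_diff[of \<one> "\<one> \<ominus> r"] by simp
  have "\<one> \<ominus> r \<noteq> \<zero>"
  proof
    assume "\<one> \<ominus> r = \<zero>"
    then have "\<one> \<prec> \<zero>" using gt by simp
    then show False using lt_trans[of \<zero> \<one> \<zero>] one_pos lt_irrefl[of \<zero>] by simp
  qed
  then obtain y where y: "y \<in> carrier R" "y \<otimes> (\<one> \<ominus> r) = \<one>"
    using nonzero_inverse[of "\<one> \<ominus> r"] r by auto
  then have "\<one> \<ominus> y \<in> unit_interval"
    using inverse_gt_one_in_unit_interval[of "\<one> \<ominus> r" y] gt r unit_interval_compl by auto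
  moreover have "(\<one> \<ominus> y) \<otimes> (\<one> \<ominus> r) = \<one> \<ominus> r \<ominus> y \<otimes> (\<one> \<ominus> r)" using y(1) r by algebra
  then have "(\<one> \<ominus> y) \<otimes> (\<one> \<ominus> r) = \<ominus> r" using y(2) r by (simp, algebra)
  ultimately show ?thesis by blast
qed

text \<open>The three positions of r relative to the scalars 0 and 1: between them, beyond 1, or on
  the far side of 0. In each case the s of the conclusion is the parameter of the middle
  point.\<close>

lemma unit_interval_trichotomy:
  assumes r: "r \<in> carrier R"
  obtains "r \<in> unit_interval"
  | s where "s \<in> unit_interval" "s \<otimes> r = \<one>"
  | s where "s \<in> unit_interval" "s \<otimes> (\<one> \<ominus> r) = \<ominus> r"
  using pos_cases[OF r] pos_unit_interval_cases[OF r] neg_unit_interval[OF r] zero_in_unit_interval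
  by blast

text \<open>Provides the centre of a parallelogram. The element 1 + 1 is positive, hence invertible,
  and exceeds 1, which puts its inverse into the interval.\<close>

lemma half_in_unit_interval:
  obtains h where "h \<in> unit_interval" "h \<oplus> h = \<one>"
proof -
  have "\<one> \<oplus> \<zero> \<prec> \<one> \<oplus> \<one>" using lt_add[of \<zero> \<one> \<one>] one_pos by simp
  then have gt: "\<one> \<prec> \<one> \<oplus> \<one>" by simp
  have "\<one> \<oplus> \<one> \<noteq> \<zero>" using pos_add[of \<one> \<one>] one_pos lt_irrefl[of \<zero>] by auto
  then obtain h where h: "h \<in> carrier R" "h \<otimes> (\<one> \<oplus> \<one>) = \<one>"
    using nonzero_inverse[of "\<one> \<oplus> \<one>"] by auto
  then have "h \<oplus> h = \<one>" by (simp add: r_distr)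
  then show thesis using that inverse_gt_one_in_unit_interval[OF _ h(1) gt h(2)] by simp
qed

text \<open>A converse to the second alternative of \<open>pos_unit_interval_cases\<close>; it
  recovers positivity after a map that respects products and the unit interval.\<close>

lemma pos_of_unit_interval_mult_one:
  assumes "r \<in> carrier R" "s \<in> unit_interval" "s \<otimes> r = \<one>"
  shows "\<zero> \<prec> r"
proof -
  have s: "s \<in> carrier R" using assms unit_interval_carrier by blast
  have "s \<noteq> \<zero>" using assms by auto
  then have "\<zero> \<prec> s" using assms by (auto simp: unit_interval_def)
  then show ?thesis using pos_of_mult_one[of s r] s assms m_comm[of s r] by simp
qed

end

section \<open>Ultrapowers of ordered fields\<close>

context
  fixes U :: "'i filter" and c :: "'a::linordered_field"
  assumes U: "ultrafilter U"
begin

private abbreviation K :: "('i \<Rightarrow> 'a) set named_oring" where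
  "K \<equiv> ultrapower U (named_field c)"

private abbreviation cls :: "('i \<Rightarrow> 'a) \<Rightarrow> ('i \<Rightarrow> 'a) set" where
  "cls \<equiv> up_class U (named_field c)"

lemma mem_up_class: "g \<in> cls f \<longleftrightarrow> (\<forall>\<^sub>F i in U. f i = g i)"
  by (simp add: up_class_def up_rel_def named_field_def)

lemma up_class_eq_iff: "cls f = cls g \<longleftrightarrow> (\<forall>\<^sub>F i in U. f i = g i)"
proof
  assume "cls f = cls g"
  moreover have "g \<in> cls g" by (simp add: mem_up_class)
  ultimately show "\<forall>\<^sub>F i in U. f i = g i" by (metis mem_up_class)
next
  assume fg: "\<forall>\<^sub>F i in U. f i = g i"
  have "(\<forall>\<^sub>F i in U. f i = h i) \<longleftrightarrow> (\<forall>\<^sub>F i in U. g i = h i)" for h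
    using fg by (intro eventually_subst) (auto elim: eventually_mono)
  then show "cls f = cls g" by (auto simp: mem_up_class)
qed

lemma carrier_ultrapower: "carrier K = range cls"
  by (auto simp: ultrapower_def quotient_def up_class_def named_field_def)

lemma up_class_carrier: "cls f \<in> carrier K"
  by (simp add: carrier_ultrapower)

lemma ultrapower_cases:
  assumes "X \<in> carrier K" obtains f where "X = cls f"
  using assms by (auto simp: carrier_ultrapower)

lemma ultrapower_constants:
  "\<one>\<^bsub>K\<^esub> = cls (\<lambda>_. 1)" "\<zero>\<^bsub>K\<^esub> = cls (\<lambda>_. 0)" "named K = cls (\<lambda>_. c)"
  by (simp_all add: ultrapower_def named_field_def)

text \<open>All sets in the double union coincide, because two changes of representative are
  harmless on a common large set of indices. The union is therefore this one class.\<close>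

lemma ultrapower_mult: "cls f \<otimes>\<^bsub>K\<^esub> cls g = cls (\<lambda>i. f i * g i)"
proof -
  have "cls (\<lambda>i. f' i * g' i) = cls (\<lambda>i. f i * g i)" if "f' \<in> cls f" "g' \<in> cls g" for f' g'
    using that unfolding mem_up_class up_class_eq_iff by eventually_elim simp
  moreover have "f \<in> cls f" "g \<in> cls g" by (simp_all add: mem_up_class)
  ultimately have "(\<Union>f'\<in>cls f. \<Union>g'\<in>cls g. cls (\<lambda>i. f' i * g' i)) = cls (\<lambda>i. f i * g i)"
    by blast
  then show ?thesis by (simp add: ultrapower_def named_field_def)
qed

lemma ultrapower_add: "cls f \<oplus>\<^bsub>K\<^esub> cls g = cls (\<lambda>i. f i + g i)"
proof -
  have "cls (\<lambda>i. f' i + g' i) = cls (\<lambda>i. f i + g i)" if "f' \<in> cls f" "g' \<in> cls g" for f' g'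
    using that unfolding mem_up_class up_class_eq_iff by eventually_elim simp
  moreover have "f \<in> cls f" "g \<in> cls g" by (simp_all add: mem_up_class)
  ultimately have "(\<Union>f'\<in>cls f. \<Union>g'\<in>cls g. cls (\<lambda>i. f' i + g' i)) = cls (\<lambda>i. f i + g i)"
    by blast
  then show ?thesis by (simp add: ultrapower_def named_field_def)
qed

lemma ultrapower_lt: "cls f \<prec>\<^bsub>K\<^esub> cls g \<longleftrightarrow> (\<forall>\<^sub>F i in U. f i < g i)"
proof
  assume "cls f \<prec>\<^bsub>K\<^esub> cls g"
  then obtain f' g' where "f' \<in> cls f" "g' \<in> cls g" "\<forall>\<^sub>F i in U. f' i < g' i"
    by (auto simp: ultrapower_def named_field_def)
  then show "\<forall>\<^sub>F i in U. f i < g i" unfolding mem_up_class by eventually_elim simp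
next
  have "f \<in> cls f" "g \<in> cls g" by (simp_all add: mem_up_class)
  moreover assume "\<forall>\<^sub>F i in U. f i < g i"
  ultimately show "cls f \<prec>\<^bsub>K\<^esub> cls g" by (auto simp: ultrapower_def named_field_def)
qed

lemmas ultrapower_simps = ultrapower_constants ultrapower_mult ultrapower_add ultrapower_lt
  up_class_eq_iff

text \<open>Maximality of \<open>U\<close> lets negation pass through \<open>eventually\<close>.
  This makes nonzero classes invertible almost everywhere and the order linear.\<close>

lemma ultrafilter_not_eventually: "(\<not> (\<forall>\<^sub>F i in U. P i)) \<longleftrightarrow> (\<forall>\<^sub>F i in U. \<not> P i)"
proof
  assume a: "\<forall>\<^sub>F i in U. \<not> P i"
  show "\<not> (\<forall>\<^sub>F i in U. P i)"
  proof
    assume "\<forall>\<^sub>F i in U. P i"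
    with a have "\<forall>\<^sub>F i in U. False" by eventually_elim simp
    then show False using U by (simp add: ultrafilter_def eventually_False)
  qed
qed (use U in \<open>auto simp: ultrafilter_def\<close>)

lemma ultrapower_cring: "cring K"
proof (intro cringI abelian_groupI comm_monoidI; (elim ultrapower_cases)?; hypsubst?)
  fix f
  show "\<exists>y\<in>carrier K. y \<oplus>\<^bsub>K\<^esub> cls f = \<zero>\<^bsub>K\<^esub>"
    by (intro bexI[of _ "cls (\<lambda>i. - f i)"]) (simp_all add: ultrapower_simps up_class_carrier)
qed (auto simp: ultrapower_simps up_class_carrier algebra_simps)

lemma ultrapower_field: "field K"
proof (rule cring.cring_fieldI2[OF ultrapower_cring])
  show "\<zero>\<^bsub>K\<^esub> \<noteq> \<one>\<^bsub>K\<^esub>"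
    using U by (simp add: ultrapower_simps ultrafilter_def)
next
  fix X assume "X \<in> carrier K" "X \<noteq> \<zero>\<^bsub>K\<^esub>"
  then obtain f where "X = cls f" "cls f \<noteq> \<zero>\<^bsub>K\<^esub>" by (elim ultrapower_cases) simp
  then have f: "X = cls f" "\<forall>\<^sub>F i in U. f i \<noteq> 0"
    by (simp_all add: ultrapower_simps ultrafilter_not_eventually)
  \<comment> \<open>At indices where f vanishes, \<open>inverse\<close> takes the default value 0;
    these indices are negligible by the choice of f.\<close>
  have "X \<otimes>\<^bsub>K\<^esub> cls (\<lambda>i. inverse (f i)) = \<one>\<^bsub>K\<^esub>"
    using f(2) unfolding f(1) ultrapower_simps by eventually_elim simp
  then show "\<exists>Y\<in>carrier K. X \<otimes>\<^bsub>K\<^esub> Y = \<one>\<^bsub>K\<^esub>" using up_class_carrier by blast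
qed

lemma ultrapower_ordered_field_structure: "ordered_field_structure K"
proof (intro ordered_field_structure.intro ultrapower_field ordered_field_structure_axioms.intro;
    elim ultrapower_cases; hypsubst)
  fix f g
  show "cls f \<prec>\<^bsub>K\<^esub> cls g \<or> cls f = cls g \<or> cls g \<prec>\<^bsub>K\<^esub> cls f"
  proof (rule ccontr)
    assume "\<not> ?thesis"
    then have "\<forall>\<^sub>F i in U. \<not> f i < g i" "\<forall>\<^sub>F i in U. f i \<noteq> g i" "\<forall>\<^sub>F i in U. \<not> g i < f i"
      by (simp_all add: ultrapower_simps ultrafilter_not_eventually)
    then have "\<forall>\<^sub>F i in U. False" by eventually_elim auto
    then show False using ultrafilter_not_eventually[of "\<lambda>_. True"] by simp
  qed
next
  fix f show "\<not> cls f \<prec>\<^bsub>K\<^esub> cls f"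
    by (simp add: ultrapower_simps ultrafilter_not_eventually)
next
  fix f g h assume "cls f \<prec>\<^bsub>K\<^esub> cls g" "cls g \<prec>\<^bsub>K\<^esub> cls h"
  then show "cls f \<prec>\<^bsub>K\<^esub> cls h" unfolding ultrapower_simps by eventually_elim simp
next
  fix f g h assume "cls f \<prec>\<^bsub>K\<^esub> cls g"
  then show "cls f \<oplus>\<^bsub>K\<^esub> cls h \<prec>\<^bsub>K\<^esub> cls g \<oplus>\<^bsub>K\<^esub> cls h"
    unfolding ultrapower_simps by eventually_elim simp
next
  fix f g assume "\<zero>\<^bsub>K\<^esub> \<prec>\<^bsub>K\<^esub> cls f" "\<zero>\<^bsub>K\<^esub> \<prec>\<^bsub>K\<^esub> cls g"
  then show "\<zero>\<^bsub>K\<^esub> \<prec>\<^bsub>K\<^esub> cls f \<otimes>\<^bsub>K\<^esub> cls g"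
    unfolding ultrapower_simps by eventually_elim simp
qed

end

section \<open>Vectors and collinearity\<close>

locale coordinate_geometry = ordered_field_structure R for R :: "('a, 'm) oring_scheme" (structure) +
  fixes d :: nat
begin

abbreviation V :: "(nat \<Rightarrow> 'a) set" where
  "V \<equiv> coord_space d R"

definition vadd :: "(nat \<Rightarrow> 'a) \<Rightarrow> (nat \<Rightarrow> 'a) \<Rightarrow> nat \<Rightarrow> 'a" (infixl \<open>\<boxplus>\<close> 65) where
  "x \<boxplus> y = (\<lambda>i\<in>{..<d}. x i \<oplus> y i)"

definition vscale :: "'a \<Rightarrow> (nat \<Rightarrow> 'a) \<Rightarrow> nat \<Rightarrow> 'a" (infixr \<open>\<odot>\<close> 70) where
  "t \<odot> x = (\<lambda>i\<in>{..<d}. t \<otimes> x i)"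

definition vzero :: "nat \<Rightarrow> 'a" where
  "vzero = (\<lambda>i\<in>{..<d}. \<zero>)"

definition unit_vec :: "nat \<Rightarrow> nat \<Rightarrow> 'a" where
  "unit_vec j = (\<lambda>i\<in>{..<d}. if i = j then \<one> else \<zero>)"

abbreviation vneg :: "(nat \<Rightarrow> 'a) \<Rightarrow> nat \<Rightarrow> 'a" where
  "vneg x \<equiv> (\<ominus> \<one>) \<odot> x"

text \<open>The point with affine parameter t on the line from x to y. \<open>Bw\<close> and
  \<open>Qr\<close> are both equations of this form, with t in the unit interval and t the named
  constant respectively.\<close>

definition comb :: "'a \<Rightarrow> (nat \<Rightarrow> 'a) \<Rightarrow> (nat \<Rightarrow> 'a) \<Rightarrow> nat \<Rightarrow> 'a" where
  "comb t x y = (\<one> \<ominus> t) \<odot> x \<boxplus> t \<odot> y"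

lemma coord_carrier [simp]: "x \<in> V \<Longrightarrow> i < d \<Longrightarrow> x i \<in> carrier R"
  by (auto simp: coord_space_def)

lemma vec_eqI:
  assumes "x \<in> V" "y \<in> V" "\<And>i. i < d \<Longrightarrow> x i = y i"
  shows "x = y"
  using assms unfolding coord_space_def by (intro PiE_ext[of x _ _ y]) auto

lemma vec_simps [simp]:
  assumes "i < d"
  shows "(x \<boxplus> y) i = x i \<oplus> y i" "(t \<odot> x) i = t \<otimes> x i" "vzero i = \<zero>"
    "unit_vec j i = (if i = j then \<one> else \<zero>)"
    "comb t x y i = (\<one> \<ominus> t) \<otimes> x i \<oplus> t \<otimes> y i"
  using assms by (simp_all add: vadd_def vscale_def vzero_def unit_vec_def comb_def)

lemma vec_closed [simp]:
  "x \<in> V \<Longrightarrow> y \<in> V \<Longrightarrow> x \<boxplus> y \<in> V"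
  "t \<in> carrier R \<Longrightarrow> x \<in> V \<Longrightarrow> t \<odot> x \<in> V"
  "vzero \<in> V" "unit_vec j \<in> V"
  "t \<in> carrier R \<Longrightarrow> x \<in> V \<Longrightarrow> y \<in> V \<Longrightarrow> comb t x y \<in> V"
proof -
  have restr: "(\<lambda>i\<in>{..<d}. f i) \<in> V" if "\<And>i. i < d \<Longrightarrow> f i \<in> carrier R" for f
    using that by (simp add: coord_space_def)
  show add: "x \<in> V \<Longrightarrow> y \<in> V \<Longrightarrow> x \<boxplus> y \<in> V" for x y
    unfolding vadd_def by (rule restr) simp
  show scale: "t \<in> carrier R \<Longrightarrow> x \<in> V \<Longrightarrow> t \<odot> x \<in> V" for t x
    unfolding vscale_def by (rule restr) simp
  show "vzero \<in> V" "unit_vec j \<in> V"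
    unfolding vzero_def unit_vec_def by (rule restr, simp)+
  show "t \<in> carrier R \<Longrightarrow> x \<in> V \<Longrightarrow> y \<in> V \<Longrightarrow> comb t x y \<in> V"
    unfolding comb_def by (intro add scale) simp_all
qed

lemma vadd_comm: "x \<in> V \<Longrightarrow> y \<in> V \<Longrightarrow> x \<boxplus> y = y \<boxplus> x"
  by (rule vec_eqI) (auto simp: a_comm)

lemma vadd_assoc: "x \<in> V \<Longrightarrow> y \<in> V \<Longrightarrow> z \<in> V \<Longrightarrow> (x \<boxplus> y) \<boxplus> z = x \<boxplus> (y \<boxplus> z)"
  by (rule vec_eqI) (auto simp: a_assoc)

lemma vadd_zero [simp]: "x \<in> V \<Longrightarrow> x \<boxplus> vzero = x" "x \<in> V \<Longrightarrow> vzero \<boxplus> x = x"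
  by (rule vec_eqI; simp)+

lemma vscale_trivial [simp]:
  "x \<in> V \<Longrightarrow> \<zero> \<odot> x = vzero" "x \<in> V \<Longrightarrow> \<one> \<odot> x = x" "t \<in> carrier R \<Longrightarrow> t \<odot> vzero = vzero"
  by (rule vec_eqI; simp)+

lemma vscale_assoc:
  "s \<in> carrier R \<Longrightarrow> t \<in> carrier R \<Longrightarrow> x \<in> V \<Longrightarrow> s \<odot> (t \<odot> x) = (s \<otimes> t) \<odot> x"
  by (rule vec_eqI) (auto simp: m_assoc)

lemma vscale_vadd:
  "t \<in> carrier R \<Longrightarrow> x \<in> V \<Longrightarrow> y \<in> V \<Longrightarrow> t \<odot> (x \<boxplus> y) = t \<odot> x \<boxplus> t \<odot> y"
  by (rule vec_eqI) (auto simp: r_distr)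

lemma add_vscale:
  "s \<in> carrier R \<Longrightarrow> t \<in> carrier R \<Longrightarrow> x \<in> V \<Longrightarrow> (s \<oplus> t) \<odot> x = s \<odot> x \<boxplus> t \<odot> x"
  by (rule vec_eqI) (auto simp: l_distr)

lemma vadd_neg [simp]: "x \<in> V \<Longrightarrow> x \<boxplus> vneg x = vzero" "x \<in> V \<Longrightarrow> vneg x \<boxplus> x = vzero"
  by (rule vec_eqI; simp add: l_minus r_neg l_neg)+

lemma vadd_cancel:
  assumes "x \<in> V" "y \<in> V" "z \<in> V" "x \<boxplus> z = y \<boxplus> z" shows "x = y"
proof -
  have "(x \<boxplus> z) \<boxplus> vneg z = (y \<boxplus> z) \<boxplus> vneg z" using assms by simp
  then show ?thesis using assms(1-3) by (simp add: vadd_assoc)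
qed

lemma vscale_right_cancel:
  assumes "s \<in> carrier R" "t \<in> carrier R" "x \<in> V" "x \<noteq> vzero" "s \<odot> x = t \<odot> x"
  shows "s = t"
proof -
  obtain i where i: "i < d" "x i \<noteq> \<zero>" using assms vec_eqI[of x vzero] by auto
  have "s \<otimes> x i = t \<otimes> x i" using arg_cong[OF assms(5), of "\<lambda>f. f i"] i by simp
  then show ?thesis using assms i m_rcancel by auto
qed

text \<open>\<open>Bw\<close> compares only the coordinates below d; membership of y in
  \<open>V\<close> fixes the remaining values, so that the equation becomes one between
  functions.\<close>

lemma Bw_iff:
  assumes "y \<in> V"
  shows "Bw d R x y z \<longleftrightarrow> (\<exists>t\<in>unit_interval. y = comb t x z)"
proof -
  have "y = comb t x z \<longleftrightarrow> (\<forall>k<d. y k = (\<one> \<ominus> t) \<otimes> x k \<oplus> t \<otimes> z k)" for t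
  proof
    assume "\<forall>k<d. y k = (\<one> \<ominus> t) \<otimes> x k \<oplus> t \<otimes> z k"
    then show "y = comb t x z"
      using assms by (intro ext) (auto simp: comb_def vadd_def vscale_def coord_space_def PiE_def extensional_def)
  qed simp
  then show ?thesis by (auto simp: Bw_def unit_interval_def)
qed

lemma Bw_comb: "t \<in> unit_interval \<Longrightarrow> x \<in> V \<Longrightarrow> z \<in> V \<Longrightarrow> Bw d R x (comb t x z) z"
  using Bw_iff unit_interval_carrier by auto

lemma comb_swap:
  assumes "t \<in> carrier R" "x \<in> V" "y \<in> V"
  shows "comb (\<one> \<ominus> t) x y = comb t y x"
proof (rule vec_eqI)
  fix i assume "i < d"
  then have "x i \<in> carrier R" "y i \<in> carrier R" using assms by auto
  then have "(\<one> \<ominus> (\<one> \<ominus> t)) \<otimes> x i \<oplus> (\<one> \<ominus> t) \<otimes> y i = (\<one> \<ominus> t) \<otimes> y i \<oplus> t \<otimes> x i"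
    using assms(1) by algebra
  then show "comb (\<one> \<ominus> t) x y i = comb t y x i" using \<open>i < d\<close> by simp
qed (use assms in auto)

lemma Bw_commute:
  assumes "x \<in> V" "y \<in> V" "z \<in> V"
  shows "Bw d R x y z \<longleftrightarrow> Bw d R z y x"
proof -
  have "Bw d R z y x" if B: "Bw d R x y z" and "x \<in> V" "z \<in> V" for x z
  proof -
    obtain t where t: "t \<in> unit_interval" "y = comb t x z"
      using B unfolding Bw_iff[OF assms(2)] by blast
    then have "y = comb (\<one> \<ominus> t) z x" using that unit_interval_carrier by (simp add: comb_swap)
    then show ?thesis using t(1) unit_interval_compl unfolding Bw_iff[OF assms(2)] by blast
  qed
  then show ?thesis using assms by blast
qed

lemma comb_0 [simp]: "x \<in> V \<Longrightarrow> y \<in> V \<Longrightarrow> comb \<zero> x y = x"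
  and comb_1 [simp]: "x \<in> V \<Longrightarrow> y \<in> V \<Longrightarrow> comb \<one> x y = y"
  by (rule vec_eqI; simp add: a_minus_def r_neg)+

lemma comb_vzero [simp]: "t \<in> carrier R \<Longrightarrow> y \<in> V \<Longrightarrow> comb t vzero y = t \<odot> y"
  by (rule vec_eqI; simp)

section \<open>Collinearity and linear independence of two vectors\<close>

definition collinear :: "(nat \<Rightarrow> 'a) \<Rightarrow> (nat \<Rightarrow> 'a) \<Rightarrow> (nat \<Rightarrow> 'a) \<Rightarrow> bool" where
  "collinear x y z \<longleftrightarrow> Bw d R x y z \<or> Bw d R y z x \<or> Bw d R z x y"

lemma collinear_commute:
  assumes "x \<in> V" "y \<in> V" "z \<in> V"
  shows "collinear x y z \<longleftrightarrow> collinear x z y"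
  using assms Bw_commute unfolding collinear_def by blast

lemma Bw_endpoints:
  assumes "x \<in> V" "y \<in> V" shows "Bw d R x x y" "Bw d R x y y"
  using assms zero_in_unit_interval one_in_unit_interval comb_0 comb_1 Bw_iff by metis+

text \<open>Parameters measured from x multiply. With s the inverse of r, the point with parameter r
  gives back y.\<close>

lemma comb_rebase:
  assumes "s \<in> carrier R" "r \<in> carrier R" "x \<in> V" "y \<in> V"
  shows "comb s x (comb r x y) = comb (s \<otimes> r) x y"
proof (rule vec_eqI)
  fix i assume i: "i < d"
  then have "x i \<in> carrier R" "y i \<in> carrier R" using assms by auto
  then have "(\<one> \<ominus> s) \<otimes> x i \<oplus> s \<otimes> ((\<one> \<ominus> r) \<otimes> x i \<oplus> r \<otimes> y i) = (\<one> \<ominus> s \<otimes> r) \<otimes> x i \<oplus> s \<otimes> r \<otimes> y i"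
    using assms(1,2) by algebra
  then show "comb s x (comb r x y) i = comb (s \<otimes> r) x y i" using i by simp
qed (use assms in auto)

text \<open>Change of the first base point. If s (1 - r) = - r, the resulting parameter is 0 and the
  point is x.\<close>

lemma comb_left:
  assumes "s \<in> carrier R" "r \<in> carrier R" "x \<in> V" "y \<in> V"
  shows "comb s (comb r x y) y = comb (r \<oplus> s \<otimes> (\<one> \<ominus> r)) x y"
proof (rule vec_eqI)
  fix i assume i: "i < d"
  then have "x i \<in> carrier R" "y i \<in> carrier R" using assms by auto
  then have "(\<one> \<ominus> s) \<otimes> ((\<one> \<ominus> r) \<otimes> x i \<oplus> r \<otimes> y i) \<oplus> s \<otimes> y i =
      (\<one> \<ominus> (r \<oplus> s \<otimes> (\<one> \<ominus> r))) \<otimes> x i \<oplus> (r \<oplus> s \<otimes> (\<one> \<ominus> r)) \<otimes> y i"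
    using assms(1,2) by algebra
  then show "comb s (comb r x y) y i = comb (r \<oplus> s \<otimes> (\<one> \<ominus> r)) x y i" using i by simp
qed (use assms in auto)

text \<open>Each case of the trichotomy for r makes one betweenness disjunct true: the new point
  lies between x and y, beyond y, or on the far side of x.\<close>

lemma collinear_comb:
  assumes r: "r \<in> carrier R" and V: "x \<in> V" "y \<in> V"
  shows "collinear x y (comb r x y)"
  using r
proof (cases rule: unit_interval_trichotomy)
  case 1
  then have "Bw d R x (comb r x y) y" using V by (rule Bw_comb)
  then show ?thesis using V r Bw_commute[of x "comb r x y" y] by (simp add: collinear_def)
next
  case (2 s)
  then have "comb s x (comb r x y) = y" using V r unit_interval_carrier by (simp add: comb_rebase)
  then have "Bw d R x y (comb r x y)" using V 2 Bw_iff by metis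
  then show ?thesis by (simp add: collinear_def)
next
  case (3 s)
  then have "comb s (comb r x y) y = x"
    using V r unit_interval_carrier by (simp add: comb_left r_neg)
  then have "Bw d R (comb r x y) x y" using V 3 Bw_iff by metis
  then show ?thesis by (simp add: collinear_def)
qed

text \<open>Each betweenness equation is solved for z. That x and y differ excludes t = 0 in the
  first case and t = 1 in the third, where the required division would fail.\<close>

lemma collinearE:
  assumes col: "collinear x y z" and V: "x \<in> V" "y \<in> V" "z \<in> V" and neq: "x \<noteq> y"
  obtains r where "r \<in> carrier R" "z = comb r x y"
proof -
  consider t where "t \<in> unit_interval" "y = comb t x z"
    | t where "t \<in> unit_interval" "z = comb t y x"
    | t where "t \<in> unit_interval" "x = comb t z y"
    using col V by (auto simp: collinear_def Bw_iff)
  then show thesis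
  proof cases
    case (1 t)
    then have t: "t \<in> carrier R" "t \<noteq> \<zero>" using neq V unit_interval_carrier by auto
    then obtain r where r: "r \<in> carrier R" "r \<otimes> t = \<one>" using nonzero_inverse by blast
    then have "z = comb r x y" using 1(2) V t by (simp add: comb_rebase)
    then show thesis using r that by blast
  next
    case (2 t)
    then have "z = comb (\<one> \<ominus> t) x y" using V comb_swap unit_interval_carrier by simp
    then show thesis using that[of "\<one> \<ominus> t"] 2(1) unit_interval_carrier by simp
  next
    case (3 t)
    then have t: "t \<in> carrier R" "t \<noteq> \<one>" using neq V unit_interval_carrier by auto
    then have "\<one> \<ominus> t \<noteq> \<zero>" using minus_eq_zero_iff[of \<one> t] by auto
    then obtain q where q: "q \<in> carrier R" "q \<otimes> (\<one> \<ominus> t) = \<one>"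
      using nonzero_inverse[of "\<one> \<ominus> t"] t by auto
    have "x = comb (\<one> \<ominus> t) y z" using 3 t V by (simp add: comb_swap)
    then have "comb q y x = z" using q t V by (simp add: comb_rebase)
    then have "z = comb (\<one> \<ominus> q) x y" using V q comb_swap by simp
    then show thesis using that[of "\<one> \<ominus> q"] q by simp
  qed
qed

text \<open>Shows that the negation of \<open>collinear vzero u v\<close> is linear independence of
  u and v, the form in which independence is used from here on.\<close>

lemma collinear_vzero_iff:
  assumes "u \<in> V" "v \<in> V" "u \<noteq> vzero"
  shows "collinear vzero u v \<longleftrightarrow> (\<exists>r\<in>carrier R. v = r \<odot> u)"
proof
  assume "collinear vzero u v"
  then show "\<exists>r\<in>carrier R. v = r \<odot> u" using assms by (elim collinearE) auto
next
  assume "\<exists>r\<in>carrier R. v = r \<odot> u"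
  then show "collinear vzero u v" using collinear_comb[of _ vzero u] assms by auto
qed

lemma independent_nonzero:
  assumes "\<not> collinear vzero u v" "u \<in> V" "v \<in> V"
  shows "u \<noteq> vzero" "v \<noteq> vzero"
  using assms Bw_endpoints[of vzero v] Bw_endpoints(2)[of u vzero] unfolding collinear_def by auto

text \<open>If b and b' differed, dividing by b - b' would exhibit v as the multiple (a' - a) / (b -
  b') of u.\<close>

lemma independent_coeffs:
  assumes indep: "\<not> collinear vzero u v" and V: "u \<in> V" "v \<in> V"
    and K: "a \<in> carrier R" "b \<in> carrier R" "a' \<in> carrier R" "b' \<in> carrier R"
    and eq: "a \<odot> u \<boxplus> b \<odot> v = a' \<odot> u \<boxplus> b' \<odot> v"
  shows "a = a' \<and> b = b'"
proof -
  note nz = independent_nonzero[OF indep V]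
  have b: "b = b'"
  proof (rule ccontr)
    assume "b \<noteq> b'"
    then obtain q where q: "q \<in> carrier R" "q \<otimes> (b \<ominus> b') = \<one>"
      using nonzero_inverse[of "b \<ominus> b'"] K minus_eq_zero_iff[of b b'] by auto
    have "v = (q \<otimes> (a' \<ominus> a)) \<odot> u"
    proof (rule vec_eqI)
      fix i assume i: "i < d"
      have c: "u i \<in> carrier R" "v i \<in> carrier R" using V i by auto
      have e: "a \<otimes> u i \<oplus> b \<otimes> v i = a' \<otimes> u i \<oplus> b' \<otimes> v i"
        using arg_cong[OF eq, of "\<lambda>f. f i"] i by simp
      have "v i = (q \<otimes> (b \<ominus> b')) \<otimes> v i" using q c by simp
      also have "\<dots> = q \<otimes> ((a \<otimes> u i \<oplus> b \<otimes> v i) \<ominus> a \<otimes> u i \<ominus> b' \<otimes> v i)" using q(1) c K by algebra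
      also have "\<dots> = q \<otimes> (a' \<ominus> a) \<otimes> u i" unfolding e using q(1) c K by algebra
      finally show "v i = ((q \<otimes> (a' \<ominus> a)) \<odot> u) i" using i by simp
    qed (use V q K in auto)
    then show False using indep collinear_vzero_iff[OF V nz(1)] q K by blast
  qed
  then have "a \<odot> u = a' \<odot> u" using eq K V vadd_cancel[of "a \<odot> u" "a' \<odot> u" "b' \<odot> v"] by simp
  then show ?thesis using b vscale_right_cancel nz K V by blast
qed

end

section \<open>Parallelograms from betweenness\<close>

context coordinate_geometry
begin

text \<open>
  Vector addition in terms of betweenness: for independent \<open>u\<close> and \<open>v\<close> the relation says that
  \<open>0, u, p, v\<close> is a parallelogram. The point \<open>m\<close> puts \<open>p\<close> into the plane of \<open>0, u, v\<close>, where disjoint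
  lines are parallel; for dependent \<open>u\<close> and \<open>v\<close> the relation is empty.
\<close>

definition parallelogram :: "(nat \<Rightarrow> 'a) \<Rightarrow> (nat \<Rightarrow> 'a) \<Rightarrow> (nat \<Rightarrow> 'a) \<Rightarrow> bool" where
  "parallelogram u v p \<longleftrightarrow>
     (\<exists>m\<in>V. Bw d R u m v \<and> Bw d R vzero m p) \<and>
     (\<forall>w\<in>V. \<not> (collinear u p w \<and> collinear vzero v w)) \<and>
     (\<forall>w\<in>V. \<not> (collinear v p w \<and> collinear vzero u w))"

text \<open>Otherwise v itself would be a common point of the line through v and p and the line
  through 0 and u, which the definition forbids.\<close>

lemma parallelogram_independent:
  assumes "parallelogram u v p" "u \<in> V" "v \<in> V" "p \<in> V"
  shows "\<not> collinear vzero u v"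
  using assms Bw_endpoints[of v p] Bw_endpoints[of p v] Bw_commute[of p v v]
  unfolding parallelogram_def collinear_def by blast

text \<open>Along the line from u to p the coefficient of u at parameter r is 1 - r (1 - e). Unless
  e = 1, it vanishes for r the inverse of 1 - e, and there the line meets the one through 0 and
  v.\<close>

lemma disjoint_lines_coeff:
  assumes disj: "\<forall>w\<in>V. \<not> (collinear u p w \<and> collinear vzero v w)"
    and V: "u \<in> V" "v \<in> V" and K: "e \<in> carrier R" "f \<in> carrier R"
    and p: "p = e \<odot> u \<boxplus> f \<odot> v"
  shows "e = \<one>"
proof (rule ccontr)
  assume "e \<noteq> \<one>"
  then obtain r where r: "r \<in> carrier R" "r \<otimes> (\<one> \<ominus> e) = \<one>"
    using nonzero_inverse[of "\<one> \<ominus> e"] K minus_eq_zero_iff[of \<one> e] by auto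
  have "comb r u p = (r \<otimes> f) \<odot> v"
  proof (rule vec_eqI)
    fix i assume i: "i < d"
    have c: "u i \<in> carrier R" "v i \<in> carrier R" using V i by auto
    have "(\<one> \<ominus> r) \<otimes> u i \<oplus> r \<otimes> (e \<otimes> u i \<oplus> f \<otimes> v i)
        = (\<one> \<ominus> r \<otimes> (\<one> \<ominus> e)) \<otimes> u i \<oplus> r \<otimes> f \<otimes> v i"
      using c K r(1) by algebra
    also have "\<dots> = r \<otimes> f \<otimes> v i" unfolding r(2) using c K r(1) by algebra
    finally show "comb r u p i = ((r \<otimes> f) \<odot> v) i" using i by (simp add: p)
  qed (use V K r p in auto)
  moreover have "collinear u p (comb r u p)" using collinear_comb V K r p by simp
  moreover have "collinear vzero v ((r \<otimes> f) \<odot> v)"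
    using collinear_comb[of "r \<otimes> f" vzero v] V K r by simp
  ultimately show False using disj V K r by (metis m_closed vec_closed(2))
qed

text \<open>The point m is a combination of u and v and also a multiple b p, so p lies in their
  plane. Disjointness of the two pairs of lines then forces both coefficients of p to be 1.\<close>

lemma parallelogram_imp:
  assumes para: "parallelogram u v p" and V: "u \<in> V" "v \<in> V" "p \<in> V"
  shows "p = u \<boxplus> v"
proof -
  note indep = parallelogram_independent[OF para V]
  obtain a b where a: "a \<in> unit_interval" and b: "b \<in> unit_interval"
    and eq: "comb a u v = comb b vzero p"
    using para V by (auto simp: parallelogram_def Bw_iff)
  have K: "a \<in> carrier R" "b \<in> carrier R" using a b unit_interval_carrier by auto
  \<comment> \<open>If b = 0, then m is the origin and lies between u and v, contrary to
    independence.\<close>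
  have "b \<noteq> \<zero>"
  proof
    assume "b = \<zero>"
    then have "Bw d R u vzero v" using eq Bw_comb[OF a V(1,2)] V by simp
    then show False using indep Bw_commute[of u vzero v] V by (auto simp: collinear_def)
  qed
  then obtain q where q: "q \<in> carrier R" "q \<otimes> b = \<one>" using nonzero_inverse K by blast
  have "p = q \<odot> (b \<odot> p)" using q V K by (simp add: vscale_assoc)
  also have "\<dots> = q \<odot> comb a u v" using eq V K by simp
  also have "\<dots> = (q \<otimes> (\<one> \<ominus> a)) \<odot> u \<boxplus> (q \<otimes> a) \<odot> v"
    using V K q by (simp add: comb_def vscale_vadd vscale_assoc)
  finally have p: "p = (q \<otimes> (\<one> \<ominus> a)) \<odot> u \<boxplus> (q \<otimes> a) \<odot> v" .
  have "q \<otimes> (\<one> \<ominus> a) = \<one>"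
    using disjoint_lines_coeff[OF _ V(1,2) _ _ p] para K q by (simp add: parallelogram_def)
  moreover have "q \<otimes> a = \<one>"
    using disjoint_lines_coeff[of v p u "q \<otimes> a" "q \<otimes> (\<one> \<ominus> a)"] p para V K q
    by (simp add: parallelogram_def vadd_comm)
  ultimately show ?thesis using p V by simp
qed

text \<open>On the line through u and u + v the coefficient of u is always 1, on the line through 0
  and v it is always 0.\<close>

lemma parallelogram_disjoint:
  assumes indep: "\<not> collinear vzero u v" and V: "u \<in> V" "v \<in> V" "w \<in> V"
  shows "\<not> (collinear u (u \<boxplus> v) w \<and> collinear vzero v w)"
proof (intro notI, elim conjE)
  assume col: "collinear u (u \<boxplus> v) w" "collinear vzero v w"
  note nz = independent_nonzero[OF indep V(1,2)]
  have "u \<noteq> u \<boxplus> v"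
    using vadd_cancel[of v vzero u] V nz by (auto simp: vadd_comm)
  then obtain r where r: "r \<in> carrier R" "w = comb r u (u \<boxplus> v)"
    using collinearE[OF col(1)] V by auto
  obtain s where s: "s \<in> carrier R" "w = s \<odot> v"
    using col(2) V nz collinear_vzero_iff by auto
  have "w = u \<boxplus> r \<odot> v"
  proof (rule vec_eqI)
    fix i assume i: "i < d"
    have c: "u i \<in> carrier R" "v i \<in> carrier R" using V i by auto
    have "(\<one> \<ominus> r) \<otimes> u i \<oplus> r \<otimes> (u i \<oplus> v i) = u i \<oplus> r \<otimes> v i" using r(1) c by algebra
    then show "w i = (u \<boxplus> r \<odot> v) i" using i r(2) by simp
  qed (use V r in auto)
  then have "\<one> \<odot> u \<boxplus> r \<odot> v = \<zero> \<odot> u \<boxplus> s \<odot> v" using s V by simp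
  then show False using independent_coeffs[OF indep V(1,2), of \<one> r \<zero> s] r s by simp
qed

lemma parallelogram_vadd:
  assumes indep: "\<not> collinear vzero u v" and V: "u \<in> V" "v \<in> V"
  shows "parallelogram u v (u \<boxplus> v)"
proof -
  \<comment> \<open>The diagonals bisect each other, so the point at parameter one half serves as m
    for both.\<close>
  obtain h where h: "h \<in> unit_interval" "h \<oplus> h = \<one>" by (rule half_in_unit_interval)
  have hK: "h \<in> carrier R" using h unit_interval_carrier by blast
  have "\<one> \<ominus> h = (h \<oplus> h) \<ominus> h" by (simp add: h)
  also have "\<dots> = h" using hK by algebra
  finally have "comb h u v = h \<odot> (u \<boxplus> v)" using hK V by (simp add: comb_def vscale_vadd)
  then have "Bw d R u (comb h u v) v" "Bw d R vzero (comb h u v) (u \<boxplus> v)"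
    using Bw_comb[OF h(1), of u v] Bw_comb[OF h(1), of vzero "u \<boxplus> v"] hK V by auto
  moreover have "\<not> collinear vzero v u" using indep V collinear_commute vec_closed(3) by blast
  ultimately show ?thesis
    using parallelogram_disjoint[OF indep V] parallelogram_disjoint[of v u] V hK vadd_comm[of u v]
    unfolding parallelogram_def by (metis vec_closed(5))
qed

text \<open>A unit vector along an axis j other than an axis k on which u is nonzero: a multiple of
  u that vanishes at k is the zero vector.\<close>

lemma exists_independent:
  assumes "2 \<le> d" "u \<in> V" "u \<noteq> vzero"
  obtains w where "w \<in> V" "\<not> collinear vzero u w"
proof -
  obtain k where k: "k < d" "u k \<noteq> \<zero>" using assms vec_eqI[of u vzero] by auto
  obtain j where j: "j < d" "j \<noteq> k"
    using assms(1) by (intro that[of "if k = 0 then 1 else 0"]) auto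
  have "\<not> collinear vzero u (unit_vec j)"
  proof
    assume "collinear vzero u (unit_vec j)"
    then obtain r where r: "r \<in> carrier R" "unit_vec j = r \<odot> u"
      using assms collinear_vzero_iff by auto
    have "r \<otimes> u k = \<zero>" "r \<otimes> u j = \<one>"
      using arg_cong[OF r(2), of "\<lambda>f. f k"] arg_cong[OF r(2), of "\<lambda>f. f j"] j k by auto
    then have "r = \<zero>" using k r assms integral_iff by auto
    then show False using \<open>r \<otimes> u j = \<one>\<close> j assms by simp
  qed
  then show thesis by (rule that[rotated]) simp
qed

lemma unit_vec_nonzero: "i < d \<Longrightarrow> unit_vec i \<noteq> vzero"
  using vec_simps(3,4)[of i] by (metis one_not_zero)

lemma unit_vec_independent:
  assumes "i < d" "j < d" "i \<noteq> j"
  shows "\<not> collinear vzero (unit_vec i) (unit_vec j)"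
proof
  assume "collinear vzero (unit_vec i) (unit_vec j)"
  then obtain r where r: "r \<in> carrier R" "unit_vec j = r \<odot> unit_vec i"
    using collinear_vzero_iff unit_vec_nonzero assms by auto
  show False using arg_cong[OF r(2), of "\<lambda>f. f j"] r(1) assms by auto
qed

end

section \<open>Bijections preserving betweenness\<close>

text \<open>An automorphism after the translation that makes it fix the origin. Betweenness is an
  equivalence here, so lines can also be pulled back along \<beta>.\<close>

locale betweenness_map = coordinate_geometry +
  fixes \<beta> :: "(nat \<Rightarrow> 'a) \<Rightarrow> nat \<Rightarrow> 'a"
  assumes dim: "2 \<le> d"
    and bij: "bij_betw \<beta> V V"
    and zero [simp]: "\<beta> vzero = vzero"
    and Bw_map: "\<lbrakk>x \<in> V; y \<in> V; z \<in> V\<rbrakk> \<Longrightarrow> Bw d R (\<beta> x) (\<beta> y) (\<beta> z) \<longleftrightarrow> Bw d R x y z"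
begin

lemma closed [simp]: "x \<in> V \<Longrightarrow> \<beta> x \<in> V"
  using bij bij_betwE by blast

lemma inject: "x \<in> V \<Longrightarrow> y \<in> V \<Longrightarrow> \<beta> x = \<beta> y \<longleftrightarrow> x = y"
  using bij by (auto simp: bij_betw_def inj_on_def)

lemma surjE:
  assumes "y \<in> V" obtains x where "x \<in> V" "y = \<beta> x"
  using bij assms by (auto simp: bij_betw_def)

lemma eq_vzero_iff: "x \<in> V \<Longrightarrow> \<beta> x = vzero \<longleftrightarrow> x = vzero"
  using inject[of x vzero] by simp

lemma collinear_map:
  "\<lbrakk>x \<in> V; y \<in> V; z \<in> V\<rbrakk> \<Longrightarrow> collinear (\<beta> x) (\<beta> y) (\<beta> z) \<longleftrightarrow> collinear x y z"
  by (simp add: collinear_def Bw_map)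

lemma collinear_map_vzero:
  "\<lbrakk>y \<in> V; z \<in> V\<rbrakk> \<Longrightarrow> collinear vzero (\<beta> y) (\<beta> z) \<longleftrightarrow> collinear vzero y z"
  using collinear_map[of vzero y z] by simp

lemma parallelogram_map:
  assumes V: "u \<in> V" "v \<in> V" "p \<in> V" and para: "parallelogram u v p"
  shows "parallelogram (\<beta> u) (\<beta> v) (\<beta> p)"
  unfolding parallelogram_def
proof (intro conjI ballI)
  obtain m where m: "m \<in> V" "Bw d R u m v" "Bw d R vzero m p"
    using para by (auto simp: parallelogram_def)
  have "Bw d R (\<beta> u) (\<beta> m) (\<beta> v)" using m V by (simp add: Bw_map)
  moreover have "Bw d R vzero (\<beta> m) (\<beta> p)" using m V Bw_map[of vzero m p] by simp
  ultimately show "\<exists>m\<in>V. Bw d R (\<beta> u) m (\<beta> v) \<and> Bw d R vzero m (\<beta> p)"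
    using m(1) closed by blast
next
  \<comment> \<open>Disjointness quantifies over all points of the space, so every point has to be
    written as an image; here surjectivity of \<beta> enters.\<close>
  fix w assume "w \<in> V"
  then obtain x where x: "x \<in> V" "w = \<beta> x" by (rule surjE)
  show "\<not> (collinear (\<beta> u) (\<beta> p) w \<and> collinear vzero (\<beta> v) w)"
    "\<not> (collinear (\<beta> v) (\<beta> p) w \<and> collinear vzero (\<beta> u) w)"
    using x V para by (auto simp: parallelogram_def collinear_map collinear_map_vzero)
qed

lemma add_independent:
  assumes "\<not> collinear vzero u v" "u \<in> V" "v \<in> V"
  shows "\<beta> (u \<boxplus> v) = \<beta> u \<boxplus> \<beta> v"
  using parallelogram_map[OF _ _ _ parallelogram_vadd[OF assms]] assms by (intro parallelogram_imp) auto

(* For dependent u and v, compare both groupings of u + v + w with w independent of u. *)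
lemma additive:
  assumes V: "u \<in> V" "v \<in> V"
  shows "\<beta> (u \<boxplus> v) = \<beta> u \<boxplus> \<beta> v"
proof (cases "u = vzero \<or> v = vzero \<or> \<not> collinear vzero u v")
  case True
  then show ?thesis using V add_independent by auto
next
  case False
  then have nz: "u \<noteq> vzero" "v \<noteq> vzero" by auto
  obtain t where t: "t \<in> carrier R" "v = t \<odot> u"
    using False V collinear_vzero_iff by auto
  have tnz: "t \<noteq> \<zero>" using nz t V by auto
  obtain w where w: "w \<in> V" "\<not> collinear vzero u w"
    using exists_independent[OF dim V(1) nz(1)] .
  have dep: "collinear vzero u w" if "s \<in> carrier R" "w = s \<odot> u" for s
    using that V nz collinear_vzero_iff w by auto
  have scaled: "\<not> collinear vzero (a \<odot> u) w" if "a \<in> carrier R" "a \<odot> u \<noteq> vzero" for a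
  proof
    assume "collinear vzero (a \<odot> u) w"
    then obtain s where "s \<in> carrier R" "w = s \<odot> (a \<odot> u)"
      using collinear_vzero_iff[of "a \<odot> u" w] \<open>a \<in> carrier R\<close> \<open>a \<odot> u \<noteq> vzero\<close> V w by auto
    then show False using dep[of "s \<otimes> a"] w that V by (simp add: vscale_assoc)
  qed
  \<comment> \<open>Otherwise w = - v + (v + w) would be a multiple of u, as v is one.\<close>
  have "\<not> collinear vzero u (v \<boxplus> w)"
  proof
    assume "collinear vzero u (v \<boxplus> w)"
    then obtain r where r: "r \<in> carrier R" "v \<boxplus> w = r \<odot> u"
      using collinear_vzero_iff V w nz by auto
    have "w = vneg v \<boxplus> (v \<boxplus> w)" using V w by (simp flip: vadd_assoc)
    also have "\<dots> = (\<ominus> \<one> \<otimes> t) \<odot> u \<boxplus> r \<odot> u"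
      unfolding r(2) unfolding t(2) using r(1) t(1) V by (subst vscale_assoc) simp_all
    also have "\<dots> = (\<ominus> \<one> \<otimes> t \<oplus> r) \<odot> u"
      using r(1) t(1) V by (intro add_vscale[symmetric]) simp_all
    finally have "collinear vzero u w" by (rule dep[rotated]) (use r(1) t(1) in simp)
    then show False using w(2) by contradiction
  qed
  then have "\<beta> (u \<boxplus> (v \<boxplus> w)) = \<beta> u \<boxplus> \<beta> (v \<boxplus> w)"
    using V w by (simp add: add_independent)
  also have "\<beta> (v \<boxplus> w) = \<beta> v \<boxplus> \<beta> w"
    using scaled[of t] nz t V w add_independent by simp
  finally have 1: "\<beta> ((u \<boxplus> v) \<boxplus> w) = (\<beta> u \<boxplus> \<beta> v) \<boxplus> \<beta> w"
    using V w by (simp add: vadd_assoc)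
  have uv: "u \<boxplus> v = (\<one> \<oplus> t) \<odot> u" using t V by (simp add: add_vscale)
  have 2: "\<beta> ((u \<boxplus> v) \<boxplus> w) = \<beta> (u \<boxplus> v) \<boxplus> \<beta> w"
  \<comment> \<open>When v = - u the sum is not independent of w, and the claim holds because
    \<beta> fixes the origin.\<close>
  proof (cases "u \<boxplus> v = vzero")
    case True
    then show ?thesis using w by simp
  next
    case False
    then show ?thesis using scaled[of "\<one> \<oplus> t"] uv t V w add_independent by simp
  qed
  show ?thesis by (rule vadd_cancel[of _ _ "\<beta> w"]) (use 1 2 V w in auto)
qed

text \<open>The line through 0 and u is mapped into the line through 0 and its image. At this stage
  s may depend on u as well as on t.\<close>

lemma scale_exists:
  assumes "u \<in> V" "t \<in> carrier R"
  shows "\<exists>s\<in>carrier R. \<beta> (t \<odot> u) = s \<odot> \<beta> u"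
proof (cases "u = vzero")
  case False
  then have "collinear vzero u (t \<odot> u)" using assms collinear_vzero_iff by auto
  then have "collinear vzero (\<beta> u) (\<beta> (t \<odot> u))" using assms by (simp add: collinear_map_vzero)
  moreover have "\<beta> u \<noteq> vzero" using False assms by (simp add: eq_vzero_iff)
  ultimately show ?thesis
    using collinear_vzero_iff[of "\<beta> u" "\<beta> (t \<odot> u)"] assms by simp
qed (use assms in auto)

(* t (u + v) is mapped to a multiple k of the image of u + v; comparing coefficients gives s = k. *)
lemma scale_transfer:
  assumes indep: "\<not> collinear vzero u v" and V: "u \<in> V" "v \<in> V"
    and K: "t \<in> carrier R" "s \<in> carrier R" and s: "\<beta> (t \<odot> u) = s \<odot> \<beta> u"
  shows "\<beta> (t \<odot> v) = s \<odot> \<beta> v"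
proof -
  obtain s' where s': "s' \<in> carrier R" "\<beta> (t \<odot> v) = s' \<odot> \<beta> v"
    using scale_exists V K by blast
  obtain k where k: "k \<in> carrier R" "\<beta> (t \<odot> (u \<boxplus> v)) = k \<odot> \<beta> (u \<boxplus> v)"
    using scale_exists[of "u \<boxplus> v" t] V K by auto
  have "s \<odot> \<beta> u \<boxplus> s' \<odot> \<beta> v = k \<odot> \<beta> u \<boxplus> k \<odot> \<beta> v"
    using k s s' V K by (simp add: additive vscale_vadd)
  then have "s = k \<and> s' = k"
    using independent_coeffs[of "\<beta> u" "\<beta> v" s s' k k] indep V K k s'
    by (simp add: collinear_map_vzero)
  then show ?thesis using s' by simp
qed

text \<open>The factor is read off from the first coordinate axis. It is unique because the image of
  \<open>unit_vec 0\<close> is nonzero.\<close>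

definition \<sigma> :: "'a \<Rightarrow> 'a" where
  "\<sigma> t = (SOME s. s \<in> carrier R \<and> \<beta> (t \<odot> unit_vec 0) = s \<odot> \<beta> (unit_vec 0))"

lemma \<sigma>_unit_vec:
  assumes "t \<in> carrier R"
  shows "\<sigma> t \<in> carrier R" "\<beta> (t \<odot> unit_vec 0) = \<sigma> t \<odot> \<beta> (unit_vec 0)"
proof -
  have "\<exists>s. s \<in> carrier R \<and> \<beta> (t \<odot> unit_vec 0) = s \<odot> \<beta> (unit_vec 0)"
    using scale_exists[OF vec_closed(4) assms] by (simp add: Bex_def)
  from someI_ex[OF this] show "\<sigma> t \<in> carrier R" "\<beta> (t \<odot> unit_vec 0) = \<sigma> t \<odot> \<beta> (unit_vec 0)"
    by (simp_all add: \<sigma>_def)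
qed

lemma \<sigma>_closed [simp]: "t \<in> carrier R \<Longrightarrow> \<sigma> t \<in> carrier R"
  by (rule \<sigma>_unit_vec)

lemma unit_vec_0_nonzero: "unit_vec 0 \<noteq> vzero" "\<beta> (unit_vec 0) \<noteq> vzero"
  using unit_vec_nonzero[of 0] dim eq_vzero_iff[of "unit_vec 0"] by auto

lemma \<sigma>_eqI:
  assumes "t \<in> carrier R" "s \<in> carrier R" "\<beta> (t \<odot> unit_vec 0) = s \<odot> \<beta> (unit_vec 0)"
  shows "\<sigma> t = s"
  using assms \<sigma>_unit_vec[of t] unit_vec_0_nonzero(2)
    vscale_right_cancel[of "\<sigma> t" s "\<beta> (unit_vec 0)"] by simp

(* s (t e_0 + e_1) is mapped to a multiple k of the image of t e_0 + e_1; comparing coefficients. *)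
lemma \<sigma>_mult:
  assumes K: "s \<in> carrier R" "t \<in> carrier R"
  shows "\<sigma> (s \<otimes> t) = \<sigma> s \<otimes> \<sigma> t"
proof -
  let ?e = "unit_vec 0" and ?f = "unit_vec 1"
  have indep: "\<not> collinear vzero ?e ?f" using unit_vec_independent[of 0 1] dim by simp
  obtain k where k: "k \<in> carrier R" "\<beta> (s \<odot> (t \<odot> ?e \<boxplus> ?f)) = k \<odot> \<beta> (t \<odot> ?e \<boxplus> ?f)"
    using scale_exists[of "t \<odot> ?e \<boxplus> ?f" s] K by auto
  have f: "\<beta> (s \<odot> ?f) = \<sigma> s \<odot> \<beta> ?f"
    using scale_transfer[OF indep] \<sigma>_unit_vec K by simp
  have "\<beta> (s \<odot> (t \<odot> ?e \<boxplus> ?f)) = \<sigma> (s \<otimes> t) \<odot> \<beta> ?e \<boxplus> \<sigma> s \<odot> \<beta> ?f"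
    using K \<sigma>_unit_vec f by (simp add: vscale_vadd vscale_assoc additive)
  moreover have "k \<odot> \<beta> (t \<odot> ?e \<boxplus> ?f) = (k \<otimes> \<sigma> t) \<odot> \<beta> ?e \<boxplus> k \<odot> \<beta> ?f"
    using K k \<sigma>_unit_vec by (simp add: vscale_vadd vscale_assoc additive)
  ultimately have "\<sigma> (s \<otimes> t) = k \<otimes> \<sigma> t \<and> \<sigma> s = k"
    using independent_coeffs[of "\<beta> ?e" "\<beta> ?f" "\<sigma> (s \<otimes> t)" "\<sigma> s" "k \<otimes> \<sigma> t" k]
      indep K k by (simp add: collinear_map_vzero)
  then show ?thesis by simp
qed

text \<open>Off the first axis the factor is transferred from \<open>unit_vec 0\<close>, which is
  independent of u. On the axis, the zero vector included, u is a multiple of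
  \<open>unit_vec 0\<close> and multiplicativity of \<sigma> applies.\<close>

lemma scale:
  assumes V: "u \<in> V" and K: "t \<in> carrier R"
  shows "\<beta> (t \<odot> u) = \<sigma> t \<odot> \<beta> u"
proof (cases "collinear vzero (unit_vec 0) u")
  case True
  then obtain r where "r \<in> carrier R" "u = r \<odot> unit_vec 0"
    using collinear_vzero_iff V unit_vec_0_nonzero by auto
  then show ?thesis using K \<sigma>_unit_vec by (simp add: vscale_assoc \<sigma>_mult)
next
  case False
  then show ?thesis using scale_transfer[OF False] V K \<sigma>_unit_vec by simp
qed

lemma \<sigma>_add:
  assumes "s \<in> carrier R" "t \<in> carrier R" shows "\<sigma> (s \<oplus> t) = \<sigma> s \<oplus> \<sigma> t"
  by (rule \<sigma>_eqI) (use assms in \<open>simp_all add: add_vscale additive \<sigma>_unit_vec\<close>)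

lemma \<sigma>_one [simp]: "\<sigma> \<one> = \<one>" and \<sigma>_zero [simp]: "\<sigma> \<zero> = \<zero>"
  by (rule \<sigma>_eqI; simp)+

lemma \<sigma>_inject:
  assumes "s \<in> carrier R" "t \<in> carrier R" "\<sigma> s = \<sigma> t" shows "s = t"
proof -
  have "\<beta> (s \<odot> unit_vec 0) = \<beta> (t \<odot> unit_vec 0)" using assms by (simp add: \<sigma>_unit_vec)
  then have "s \<odot> unit_vec 0 = t \<odot> unit_vec 0" using inject assms by simp
  then show ?thesis using vscale_right_cancel assms unit_vec_0_nonzero vec_closed(4) by blast
qed

text \<open>The point with factor s on the image axis has a preimage under \<beta>, which lies on
  the first axis because collinearity is also reflected.\<close>

lemma \<sigma>_surj:
  assumes "s \<in> carrier R" obtains t where "t \<in> carrier R" "\<sigma> t = s"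
proof -
  obtain y where y: "y \<in> V" "s \<odot> \<beta> (unit_vec 0) = \<beta> y"
    using surjE[of "s \<odot> \<beta> (unit_vec 0)"] assms by auto
  have "collinear vzero (\<beta> (unit_vec 0)) (\<beta> y)"
    using collinear_vzero_iff[of "\<beta> (unit_vec 0)" "\<beta> y"] unit_vec_0_nonzero y(1) assms
      y(2)[symmetric] by auto
  then have "collinear vzero (unit_vec 0) y" using y collinear_map_vzero by simp
  then obtain t where "t \<in> carrier R" "y = t \<odot> unit_vec 0"
    using collinear_vzero_iff unit_vec_0_nonzero y by auto
  then show thesis using that \<sigma>_eqI y assms by auto
qed

lemma \<sigma>_ring_iso: "\<sigma> \<in> ring_iso R R"
proof (rule ring_iso_memI)
  show "bij_betw \<sigma> (carrier R) (carrier R)"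
    unfolding bij_betw_def using \<sigma>_inject \<sigma>_surj by (force simp: inj_on_def)
qed (simp_all add: \<sigma>_mult \<sigma>_add)

text \<open>Expresses membership in the unit interval by betweenness, so that \<beta> carries it
  from t to \<open>\<sigma> t\<close>. As u is nonzero, the parameter of a point on its line is
  unique.\<close>

lemma Bw_scaled:
  assumes "u \<in> V" "u \<noteq> vzero" "t \<in> carrier R"
  shows "Bw d R vzero (t \<odot> u) u \<longleftrightarrow> t \<in> unit_interval"
proof -
  have "t \<odot> u = comb r vzero u \<longleftrightarrow> t = r" if "r \<in> unit_interval" for r
    using that assms vscale_right_cancel[of t r u] unit_interval_carrier by auto
  then show ?thesis using assms Bw_iff[of "t \<odot> u" vzero u] by auto
qed

lemma \<sigma>_unit_interval:
  assumes "t \<in> carrier R" shows "\<sigma> t \<in> unit_interval \<longleftrightarrow> t \<in> unit_interval"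
  using Bw_map[of vzero "t \<odot> unit_vec 0" "unit_vec 0"] assms unit_vec_0_nonzero
    Bw_scaled[of "unit_vec 0" t] Bw_scaled[of "\<beta> (unit_vec 0)" "\<sigma> t"]
  by (simp add: \<sigma>_unit_vec)

text \<open>A positive t lies in the unit interval or has its inverse there. \<sigma> preserves the
  interval and inverses, and injectivity keeps the image away from 0.\<close>

lemma \<sigma>_pos:
  assumes t: "t \<in> carrier R" "\<zero> \<prec> t"
  shows "\<zero> \<prec> \<sigma> t"
  using pos_unit_interval_cases[OF t]
proof (elim disjE bexE)
  assume "t \<in> unit_interval"
  then have "\<sigma> t \<in> unit_interval" using t \<sigma>_unit_interval by simp
  moreover have "\<sigma> t \<noteq> \<zero>" using \<sigma>_inject[of t \<zero>] t lt_irrefl[of \<zero>] by auto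
  ultimately show ?thesis by (auto simp: unit_interval_def)
next
  fix s assume s: "s \<in> unit_interval" "s \<otimes> t = \<one>"
  then have "\<sigma> s \<otimes> \<sigma> t = \<one>" "\<sigma> s \<in> unit_interval"
    using \<sigma>_mult[of s t] t \<sigma>_unit_interval unit_interval_carrier by simp_all
  then show ?thesis using pos_of_unit_interval_mult_one t by simp
qed

lemma \<sigma>_strict_mono:
  assumes K: "x \<in> carrier R" "y \<in> carrier R" and lt: "x \<prec> y"
  shows "\<sigma> x \<prec> \<sigma> y"
proof -
  have "\<zero> \<prec> \<sigma> (y \<ominus> x)" using K lt lt_iff_pos_diff by (intro \<sigma>_pos) auto
  moreover have "\<sigma> (y \<ominus> x) \<oplus> \<sigma> x = \<sigma> y"
  proof -
    have "(y \<ominus> x) \<oplus> x = y" using K by algebra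
    then show ?thesis using \<sigma>_add[of "y \<ominus> x" x] K by simp
  qed
  ultimately show ?thesis using lt_add[of \<zero> "\<sigma> (y \<ominus> x)" "\<sigma> x"] K by simp
qed

lemma \<sigma>_lt_iff:
  assumes K: "x \<in> carrier R" "y \<in> carrier R"
  shows "x \<prec> y \<longleftrightarrow> \<sigma> x \<prec> \<sigma> y"
  using \<sigma>_strict_mono[of x y] \<sigma>_strict_mono[of y x] K lt_linear[of x y] lt_irrefl[of "\<sigma> x"]
    lt_trans[of "\<sigma> x" "\<sigma> y" "\<sigma> x"] by auto

end

section \<open>Linear maps and matrices\<close>

context coordinate_geometry
begin

definition linear_map :: "((nat \<Rightarrow> 'a) \<Rightarrow> nat \<Rightarrow> 'a) \<Rightarrow> bool" where
  "linear_map L \<longleftrightarrow>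
     (\<forall>x\<in>V. L x \<in> V) \<and> (\<forall>x\<in>V. \<forall>y\<in>V. L (x \<boxplus> y) = L x \<boxplus> L y) \<and>
     (\<forall>t\<in>carrier R. \<forall>x\<in>V. L (t \<odot> x) = t \<odot> L x)"

lemma linear_mapD:
  assumes "linear_map L"
  shows "x \<in> V \<Longrightarrow> L x \<in> V" "x \<in> V \<Longrightarrow> y \<in> V \<Longrightarrow> L (x \<boxplus> y) = L x \<boxplus> L y"
    "t \<in> carrier R \<Longrightarrow> x \<in> V \<Longrightarrow> L (t \<odot> x) = t \<odot> L x"
  using assms by (auto simp: linear_map_def)

lemma linear_map_vzero:
  assumes "linear_map L" shows "L vzero = vzero"
  using linear_mapD(3)[OF assms, of \<zero> vzero] linear_mapD(1)[OF assms, of vzero] by simp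

text \<open>Induction on the number n of coordinates of v that are kept: \<open>trunc n\<close>
  replaces the others by zero, and each step adds one multiple of a unit vector.\<close>

lemma linear_map_matrix:
  assumes L: "linear_map L" and v: "v \<in> V" and i: "i < d"
  shows "L v i = (\<Oplus>j\<in>{..<d}. L (unit_vec j) i \<otimes> v j)"
proof -
  define trunc where "trunc n = (\<lambda>k\<in>{..<d}. if k < n then v k else \<zero>)" for n
  have trunc: "trunc n \<in> V" for n
    using v unfolding trunc_def coord_space_def by (intro restrict_PiE_iff[THEN iffD2]) auto
  have "L (trunc n) i = (\<Oplus>j\<in>{..<n}. L (unit_vec j) i \<otimes> v j)" if "n \<le> d" for n
    using that
  proof (induction n)
    case 0
    have "trunc 0 = vzero" by (simp add: trunc_def vzero_def)
    then show ?case using linear_map_vzero[OF L] i by simp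
  next
    case (Suc n)
    have vn: "v n \<in> carrier R" using v Suc by simp
    have "trunc (Suc n) = trunc n \<boxplus> v n \<odot> unit_vec n"
    proof (rule vec_eqI)
      fix k assume "k < d"
      then show "trunc (Suc n) k = (trunc n \<boxplus> v n \<odot> unit_vec n) k"
        using v vn by (auto simp: trunc_def less_Suc_eq)
    qed (use trunc vn in auto)
    then have "L (trunc (Suc n)) i = L (trunc n) i \<oplus> v n \<otimes> L (unit_vec n) i"
      using L vn trunc i by (simp add: linear_mapD)
    also have "\<dots> = (\<Oplus>j\<in>{..<n}. L (unit_vec j) i \<otimes> v j) \<oplus> L (unit_vec n) i \<otimes> v n"
      using Suc vn L i by (simp add: linear_mapD m_comm)
    also have "\<dots> = (\<Oplus>j\<in>{..<Suc n}. L (unit_vec j) i \<otimes> v j)"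
    proof -
      have "(\<lambda>j. L (unit_vec j) i \<otimes> v j) \<in> {..<n} \<rightarrow> carrier R" "L (unit_vec n) i \<otimes> v n \<in> carrier R"
        using L i v Suc.prems by (auto simp: linear_mapD)
      then show ?thesis by (simp add: lessThan_Suc a_comm)
    qed
    finally show ?case .
  qed
  moreover have "trunc d = v"
    using v by (intro vec_eqI trunc) (auto simp: trunc_def)
  ultimately show ?thesis by force
qed

lemma linear_map_inverse:
  assumes L: "linear_map L" and bij: "bij_betw L V V"
  shows "linear_map (inv_into V L)"
proof -
  have closed: "inv_into V L x \<in> V" if "x \<in> V" for x
    using bij that by (metis bij_betw_def inv_into_into)
  have LI: "L (inv_into V L x) = x" if "x \<in> V" for x
    using bij that by (rule bij_betw_inv_into_right)
  have eqI: "inv_into V L x = y" if "y \<in> V" "L y = x" for x y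
    using bij that by (auto simp: bij_betw_def)
  show ?thesis
    unfolding linear_map_def
    by (intro conjI ballI closed eqI) (simp_all add: closed LI linear_mapD[OF L])
qed

text \<open>Column j is the image of the unit vector j. By \<open>linear_map_matrix\<close>, read
  from right to left, entry (i, j) of the product with the matrix of the inverse map is coordinate i
  of the unit vector j.\<close>

lemma linear_map_GL:
  assumes L: "linear_map L" and bij: "bij_betw L V V"
  shows "(\<lambda>i j. L (unit_vec j) i) \<in> GL d R"
proof -
  define L' where "L' = inv_into V L"
  have L': "linear_map L'" unfolding L'_def using L bij by (rule linear_map_inverse)
  have inv: "L (L' x) = x" "L' (L x) = x" if "x \<in> V" for x
    using bij that unfolding L'_def by (simp_all add: bij_betw_inv_into_right bij_betw_inv_into_left)
  have "inverse_mats d R (\<lambda>i j. L (unit_vec j) i) (\<lambda>i j. L' (unit_vec j) i)"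
    unfolding inverse_mats_def
    by (simp add: linear_map_matrix[OF L, symmetric] linear_map_matrix[OF L', symmetric]
        linear_mapD[OF L] linear_mapD[OF L'] inv)
  moreover have "(\<lambda>i j. L (unit_vec j) i) \<in> mats d R" "(\<lambda>i j. L' (unit_vec j) i) \<in> mats d R"
    by (simp_all add: mats_def linear_mapD[OF L] linear_mapD[OF L'])
  ultimately show ?thesis by (auto simp: GL_def)
qed

lemma affine_map_linear:
  assumes "linear_map L" "x \<in> V"
  shows "affine_map d R (\<lambda>i j. L (unit_vec j) i) b x = L x \<boxplus> b"
  unfolding affine_map_def vadd_def using assms
  by (intro restrict_ext) (simp add: linear_map_matrix[symmetric])

section \<open>Translations and coordinatewise maps\<close>

lemma comb_translate:
  assumes t: "t \<in> carrier R" and V: "x \<in> V" "y \<in> V" "b \<in> V"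
  shows "comb t (x \<boxplus> b) (y \<boxplus> b) = comb t x y \<boxplus> b"
proof (rule vec_eqI)
  fix i assume i: "i < d"
  then have "x i \<in> carrier R" "y i \<in> carrier R" "b i \<in> carrier R" using V by auto
  then have "(\<one> \<ominus> t) \<otimes> (x i \<oplus> b i) \<oplus> t \<otimes> (y i \<oplus> b i) = ((\<one> \<ominus> t) \<otimes> x i \<oplus> t \<otimes> y i) \<oplus> b i"
    using t by algebra
  then show "comb t (x \<boxplus> b) (y \<boxplus> b) i = (comb t x y \<boxplus> b) i" using i by simp
qed (use assms in auto)

lemma bij_translate:
  assumes "b \<in> V" shows "bij_betw (\<lambda>x. x \<boxplus> b) V V"
  by (rule bij_betw_byWitness[where f' = "\<lambda>x. x \<boxplus> vneg b"]) (use assms in \<open>auto simp: vadd_assoc\<close>)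

lemma Bw_translate:
  assumes V: "x \<in> V" "y \<in> V" "z \<in> V" "b \<in> V"
  shows "Bw d R (x \<boxplus> b) (y \<boxplus> b) (z \<boxplus> b) \<longleftrightarrow> Bw d R x y z"
proof -
  have "y \<boxplus> b = comb t (x \<boxplus> b) (z \<boxplus> b) \<longleftrightarrow> y = comb t x z" if "t \<in> unit_interval" for t
    using that V unit_interval_carrier vadd_cancel[of y "comb t x z" b]
    by (auto simp: comb_translate)
  then show ?thesis using V by (simp add: Bw_iff)
qed

lemma linear_map_comb:
  assumes "linear_map L" "t \<in> carrier R" "x \<in> V" "y \<in> V"
  shows "L (comb t x y) = comb t (L x) (L y)"
  using assms by (simp add: comb_def linear_mapD)

lemma bij_coordinatewise:
  assumes "bij_betw \<tau> (carrier R) (carrier R)"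
  shows "bij_betw (coordinatewise d \<tau>) V V"
proof (rule bij_betw_byWitness[where f' = "coordinatewise d (inv_into (carrier R) \<tau>)"])
  have closed: "coordinatewise d \<rho> x \<in> V"
    if "bij_betw \<rho> (carrier R) (carrier R)" "x \<in> V" for \<rho> x
    using that unfolding coordinatewise_def coord_space_def
    by (intro restrict_PiE_iff[THEN iffD2]) (auto dest: bij_betwE)
  note inv = bij_betw_inv_into[OF assms]
  show "coordinatewise d \<tau> ` V \<subseteq> V" "coordinatewise d (inv_into (carrier R) \<tau>) ` V \<subseteq> V"
    using closed assms inv by auto
  show "\<forall>x\<in>V. coordinatewise d (inv_into (carrier R) \<tau>) (coordinatewise d \<tau> x) = x"
    "\<forall>x\<in>V. coordinatewise d \<tau> (coordinatewise d (inv_into (carrier R) \<tau>) x) = x"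
    by (intro ballI vec_eqI closed assms inv; assumption?;
        simp add: coordinatewise_def bij_betw_inv_into_left[OF assms]
          bij_betw_inv_into_right[OF assms])+
qed

end

section \<open>Splitting off the scalar map\<close>

context betweenness_map
begin

abbreviation \<sigma>' :: "'a \<Rightarrow> 'a" where
  "\<sigma>' \<equiv> inv_into (carrier R) \<sigma>"

definition linear_part :: "(nat \<Rightarrow> 'a) \<Rightarrow> nat \<Rightarrow> 'a" where
  "linear_part v = \<beta> (coordinatewise d \<sigma>' v)"

lemma \<sigma>_bij: "bij_betw \<sigma> (carrier R) (carrier R)"
  using \<sigma>_ring_iso by (simp add: ring_iso_def)

lemma \<sigma>'_ring_iso: "\<sigma>' \<in> ring_iso R R"
  using \<sigma>_ring_iso ring_iso_set_sym ring_axioms by blast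

lemma coordinatewise_\<sigma>'_closed: "x \<in> V \<Longrightarrow> coordinatewise d \<sigma>' x \<in> V"
  using bij_coordinatewise[OF bij_betw_inv_into[OF \<sigma>_bij]] bij_betwE by blast

text \<open>A factor t becomes \<open>\<sigma>' t\<close> under the coordinatewise map, and \<beta>
  turns this back into \<open>\<sigma> (\<sigma>' t) = t\<close>.\<close>

lemma linear_part_linear: "linear_map linear_part"
proof -
  have hom: "\<sigma>' (x \<oplus> y) = \<sigma>' x \<oplus> \<sigma>' y" "\<sigma>' (x \<otimes> y) = \<sigma>' x \<otimes> \<sigma>' y" "\<sigma>' x \<in> carrier R"
    if "x \<in> carrier R" "y \<in> carrier R" for x y
    using that \<sigma>'_ring_iso by (auto simp: ring_iso_def ring_hom_def)
  have 1: "coordinatewise d \<sigma>' (x \<boxplus> y) = coordinatewise d \<sigma>' x \<boxplus> coordinatewise d \<sigma>' y"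
    if "x \<in> V" "y \<in> V" for x y
    by (rule vec_eqI) (use that in \<open>simp_all add: coordinatewise_\<sigma>'_closed\<close>,
        simp add: coordinatewise_def hom)
  have 2: "coordinatewise d \<sigma>' (t \<odot> x) = \<sigma>' t \<odot> coordinatewise d \<sigma>' x"
    if "x \<in> V" "t \<in> carrier R" for t x
    by (rule vec_eqI) (use that in \<open>simp_all add: coordinatewise_\<sigma>'_closed hom(3)\<close>,
        simp add: coordinatewise_def hom)
  show ?thesis
    unfolding linear_map_def linear_part_def
    using bij_betw_inv_into_right[OF \<sigma>_bij]
    by (simp add: 1 2 coordinatewise_\<sigma>'_closed additive scale hom(3))
qed

lemma linear_part_bij: "bij_betw linear_part V V"
  unfolding linear_part_def
  using bij_betw_trans[OF bij_coordinatewise[OF bij_betw_inv_into[OF \<sigma>_bij]] bij]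
  by (simp add: comp_def)

lemma linear_part_coordinatewise:
  assumes "x \<in> V" shows "linear_part (coordinatewise d \<sigma> x) = \<beta> x"
proof -
  have "coordinatewise d \<sigma>' (coordinatewise d \<sigma> x) = x"
  proof (rule vec_eqI)
    show "coordinatewise d \<sigma>' (coordinatewise d \<sigma> x) \<in> V"
      using coordinatewise_\<sigma>'_closed bij_coordinatewise[OF \<sigma>_bij] bij_betwE assms by blast
  qed (use assms bij_betw_inv_into_left[OF \<sigma>_bij] in \<open>auto simp: coordinatewise_def\<close>)
  then show ?thesis by (simp add: linear_part_def)
qed

end

section \<open>The named ratio and the final decomposition\<close>

locale named_geometry = coordinate_geometry R d
  for R :: "('a, 'm) named_oring_scheme" (structure) and d +
  assumes named_closed: "named R \<in> carrier R"
begin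

lemma Qr_iff:
  assumes "x \<in> V" "y \<in> V" "z \<in> V"
  shows "Qr d R x y z \<longleftrightarrow> y = comb (named R) x z"
proof -
  have "x k \<oplus> named R \<otimes> (z k \<ominus> x k) = comb (named R) x z k" if "k < d" for k
  proof -
    have "x k \<in> carrier R" "z k \<in> carrier R" using assms that by auto
    then have "x k \<oplus> named R \<otimes> (z k \<ominus> x k) = (\<one> \<ominus> named R) \<otimes> x k \<oplus> named R \<otimes> z k"
      using named_closed by algebra
    then show ?thesis using that by simp
  qed
  then show ?thesis
    unfolding Qr_def using assms named_closed by (auto intro!: vec_eqI[of y "comb (named R) x z"])
qed

text \<open>Both relations are built from equations y = \<open>comb t x z\<close>. Compatibility
  with \<open>comb\<close> preserves them, and injectivity of f reflects them.\<close>

lemma geom_aut_combI: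
  assumes bij: "bij_betw f V V"
    and f: "\<And>t x y. \<lbrakk>t \<in> carrier R; x \<in> V; y \<in> V\<rbrakk> \<Longrightarrow> f (comb t x y) = comb t (f x) (f y)"
  shows "f \<in> geom_aut (geometry_over d R)"
proof -
  have closed: "f x \<in> V" if "x \<in> V" for x using bij that bij_betwE by blast
  have eq: "y = comb t x z \<longleftrightarrow> f y = comb t (f x) (f z)"
    if "t \<in> carrier R" "x \<in> V" "y \<in> V" "z \<in> V" for t x y z
    using bij that f by (metis bij_betw_def inj_on_eq_iff vec_closed(5))
  have "Bw d R x y z \<longleftrightarrow> Bw d R (f x) (f y) (f z)" if "x \<in> V" "y \<in> V" "z \<in> V" for x y z
    using that eq unit_interval_carrier closed by (simp add: Bw_iff)
  moreover have "Qr d R x y z \<longleftrightarrow> Qr d R (f x) (f y) (f z)"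
    if "x \<in> V" "y \<in> V" "z \<in> V" for x y z
    using that eq[OF named_closed] closed by (simp add: Qr_iff)
  ultimately show ?thesis using bij by (simp add: geom_aut_def geometry_over_def)
qed

lemma geom_aut_semilinear:
  assumes dim: "2 \<le> d" and \<alpha>: "\<alpha> \<in> geom_aut (geometry_over d R)"
  shows "\<exists>A\<in>aff_aut d R. \<exists>\<sigma>\<in>field_aut R. \<forall>x\<in>V. \<alpha> x = (A \<circ> coordinatewise d \<sigma>) x"
proof -
  have \<alpha>_bij: "bij_betw \<alpha> V V"
    and \<alpha>_Bw: "\<And>x y z. \<lbrakk>x \<in> V; y \<in> V; z \<in> V\<rbrakk> \<Longrightarrow> Bw d R (\<alpha> x) (\<alpha> y) (\<alpha> z) \<longleftrightarrow> Bw d R x y z"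
    and \<alpha>_Qr: "\<And>x y z. \<lbrakk>x \<in> V; y \<in> V; z \<in> V\<rbrakk> \<Longrightarrow> Qr d R (\<alpha> x) (\<alpha> y) (\<alpha> z) \<longleftrightarrow> Qr d R x y z"
    using \<alpha> by (simp_all add: geom_aut_def geometry_over_def)
  have \<alpha>_closed: "\<alpha> x \<in> V" if "x \<in> V" for x using \<alpha>_bij that bij_betwE by blast
  define b where "b = \<alpha> vzero"
  have b: "b \<in> V" by (simp add: b_def \<alpha>_closed)
  define \<beta> where "\<beta> x = \<alpha> x \<boxplus> vneg b" for x
  interpret betweenness_map R d \<beta>
  proof
    show "bij_betw \<beta> V V"
      using bij_betw_trans[OF \<alpha>_bij bij_translate[of "vneg b"]] b
      by (simp add: comp_def \<beta>_def[abs_def])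
    show "\<beta> vzero = vzero" using b by (simp add: \<beta>_def flip: b_def)
    show "Bw d R (\<beta> x) (\<beta> y) (\<beta> z) \<longleftrightarrow> Bw d R x y z" if "x \<in> V" "y \<in> V" "z \<in> V" for x y z
      using that b by (simp add: \<beta>_def Bw_translate \<alpha>_closed \<alpha>_Bw)
  qed (rule dim)
  have \<alpha>_eq: "\<alpha> x = \<beta> x \<boxplus> b" if "x \<in> V" for x
    using that b \<alpha>_closed by (simp add: \<beta>_def vadd_assoc)
  \<comment> \<open>Since \<alpha> is \<beta> followed by translation by b, and \<beta> is the
    coordinatewise \<sigma> followed by \<open>linear_part\<close>, the translation is absorbed into
    the affine factor.\<close>
  let ?A = "\<lambda>x. linear_part x \<boxplus> b"
  have "?A \<in> geom_aut (geometry_over d R)"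
  proof (rule geom_aut_combI)
    show "bij_betw ?A V V"
      using bij_betw_trans[OF linear_part_bij bij_translate[OF b]] by (simp add: comp_def)
    show "?A (comb t x y) = comb t (?A x) (?A y)"
      if "t \<in> carrier R" "x \<in> V" "y \<in> V" for t x y
      using that b linear_part_linear by (simp add: linear_map_comb comb_translate linear_mapD)
  qed
  then have "?A \<in> aff_aut d R"
    unfolding aff_aut_def
    using linear_map_GL[OF linear_part_linear linear_part_bij] b
      affine_map_linear[OF linear_part_linear, symmetric] by blast
  moreover have "\<sigma> (named R) = named R"
  proof (rule \<sigma>_eqI)
    let ?e = "unit_vec 0" and ?c = "named R"
    \<comment> \<open>The point of ratio c on the very axis from which \<sigma> is read off.\<close>
    have "Qr d R vzero (?c \<odot> ?e) ?e" using named_closed by (simp add: Qr_iff)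
    then have "Qr d R (\<alpha> vzero) (\<alpha> (?c \<odot> ?e)) (\<alpha> ?e)" using named_closed by (simp add: \<alpha>_Qr)
    then have "\<alpha> (?c \<odot> ?e) = comb ?c (\<alpha> vzero) (\<alpha> ?e)"
      using named_closed by (simp add: Qr_iff \<alpha>_closed)
    then have "\<beta> (?c \<odot> ?e) \<boxplus> b = comb ?c (vzero \<boxplus> b) (\<beta> ?e \<boxplus> b)"
      using named_closed by (simp add: \<alpha>_eq)
    \<comment> \<open>The weights of \<open>comb\<close> add up to 1, so the common translation can
      be pulled out and then cancelled.\<close>
    also have "\<dots> = ?c \<odot> \<beta> ?e \<boxplus> b"
      using comb_translate[of ?c vzero "\<beta> ?e" b] named_closed b by simp
    finally show "\<beta> (?c \<odot> ?e) = ?c \<odot> \<beta> ?e"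
      using vadd_cancel[of "\<beta> (?c \<odot> ?e)" "?c \<odot> \<beta> ?e" b] named_closed b by simp
  qed (use named_closed in auto)
  then have "\<sigma> \<in> field_aut R"
    using \<sigma>_ring_iso \<sigma>_lt_iff by (simp add: field_aut_def)
  moreover have "\<forall>x\<in>V. \<alpha> x = (?A \<circ> coordinatewise d \<sigma>) x"
    by (simp add: linear_part_coordinatewise \<alpha>_eq)
  ultimately show ?thesis by blast
qed

end

theorem proposition7p1:
  fixes d :: nat and c :: "'a::linordered_field"
  assumes "d \<ge> 2"
    and "\<not> definable_element (ordered_field :: 'a oring) c"
  shows "semilinearly_faithful TYPE('i) d (named_field c)"
  unfolding semilinearly_faithful_def
proof (intro allI impI ballI)
  fix U :: "'i filter" and \<alpha>
  assume U: "ultrafilter U" and \<alpha>: "\<alpha> \<in> geom_aut (geometry_over d (ultrapower U (named_field c)))"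
  interpret ordered_field_structure "ultrapower U (named_field c)"
    using U by (rule ultrapower_ordered_field_structure)
  interpret named_geometry "ultrapower U (named_field c)" d
    by unfold_locales (simp add: ultrapower_constants[OF U] up_class_carrier[OF U])
  show "\<exists>A\<in>aff_aut d (ultrapower U (named_field c)). \<exists>\<sigma>\<in>field_aut (ultrapower U (named_field c)).
      \<forall>x\<in>coord_space d (ultrapower U (named_field c)). \<alpha> x = (A \<circ> coordinatewise d \<sigma>) x"
    using assms(1) \<alpha> by (rule geom_aut_semilinear)
qed

end
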